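(* Let $p$ and $q$ be real parameters such that $p>1$, $q>1$, $\frac1p+\frac1q\ge1$, and let $p'$ and $q'$ respectively be their conjugate exponents, that is, $\frac1p+\frac1{p'}=1$ and $\frac1q+\frac1{q'}=1$. Define $\lambda=\frac1{p'}+\frac1{q'}$ and note that $0<\lambda\le1$ for all such $p$ and $q$. Further, suppose $\tilde p\ge0$, $\tilde q\ge0$, $\alpha_1,\alpha_2>0$, $\frac12<\frac{\alpha_1}{\alpha_2}<2$, $s_1+s_2>0$. If $f$ and $g$ are non-negative measurable functions on $(0,\infty)$, then the inequalities $$ \int_0^\infty\!\!\int_0^\infty\frac{\exp\left[-(\alpha_1\tilde q+\alpha_2\tilde p)\left(\frac yx+\frac1{\alpha_1\alpha_2}\frac xy\right)\right]}{(x+\alpha_1y)^{\lambda s_1}(x+\alpha_2y)^{\lambda s_2}}f(x)g(y)\,dx\,dy\le e^{2(\tilde p+\tilde q)}K_{\tilde p,\tilde q}\left(\int_0^\infty x^{\frac p{q'}(1-s_1-s_2)+p(A_1-A_2)}f^p(x)\,dx\right)^{\frac1p}\left(\int_0^\infty y^{\frac q{p'}(1-s_1-s_2)+q(A_2-A_1)}g^q(y)\,dy\right)^{\frac1q} \quad (\mathrm{I}) $$ and $$ \left[\int_0^\infty y^{\frac{q'}{p'}(s_1+s_2-1)+q'(A_1-A_2)}\left(\int_0^\infty\frac{\exp\left[-(\alpha_1\tilde q+\alpha_2\tilde p)\left(\frac yx+\frac1{\alpha_1\alpha_2}\frac xy\right)\right]}{(x+\alpha_1y)^{\lambda s_1}(x+\alpha_2y)^{\lambda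 s_2}}f(x)\,dx\right)^{q'}dy\right]^{\frac1{q'}}\le e^{2(\tilde p+\tilde q)}K_{\tilde p,\tilde q}\left(\int_0^\infty x^{\frac p{q'}(1-s_1-s_2)+p(A_1-A_2)}f^p(x)\,dx\right)^{\frac1p} \quad (\mathrm{II}) $$ hold for any $A_1\in\left(\frac{1-s_1-s_2}{p'},\frac1{p'}\right)$ and $A_2\in\left(\frac{1-s_1-s_2}{q'},\frac1{q'}\right)$, with the constant $K_{\tilde p,\tilde q}=k(F;q'\tilde p,q'\tilde q)\,k(G;p'\tilde p,p'\tilde q)$. Inequalities (I) and (II) are equivalent. In addition, the equality in (I) and (II) holds if and only if at least one of the functions $f$ or $g$ is equal to zero.
   Context: $B(\cdot,\cdot)$ is Euler's beta function. For real $a,b,c$ with $c>b>0$, real $z<1$, and $P,Q\ge0$, the extended Gauss hypergeometric function (for the kernel $\Theta=\exp$) is given by $${}_2F_1\left[\begin{array}{c} a,b \\ c \end{array};z;P,Q\right]=\frac1{B(b,c-b)}\int_0^1t^{b-1}(1-t)^{c-b-1}(1-zt)^{-a}\exp\left(-\frac Pt-\frac Q{1-t}\right)dt .$$ For $P,Q\ge0$ the constants are $$k(F;P,Q)=\alpha_1^{A_2-\frac1{q'}}\,B(1-q'A_2,s_1+s_2+q'A_2-1)^{\frac1{q'}}\left\{{}_2F_1\left[\begin{array}{c} s_2,1-q'A_2 \\ {s_1+s_2} \end{array};\frac{\alpha_1-\alpha_2}{\alpha_1};P,Q\right]\right\}^{\frac1{q'}},$$ $$k(G;P,Q)=\alpha_1^{-\frac{s_1}{p'}}\alpha_2^{\frac{1-s_2}{p'}-A_1}\,B(1-p'A_1,s_1+s_2+p'A_1-1)^{\frac1{p'}}\left\{{}_2F_1\left[\begin{array}{c}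 s_1,1-p'A_1 \\ {s_1+s_2} \end{array};\frac{\alpha_1-\alpha_2}{\alpha_1};P,Q\right]\right\}^{\frac1{p'}}.$$
   Formalization: The equality cases are stated when the right-hand side is finite (otherwise both sides may be infinite for nonzero f, g), "equal to zero" means almost everywhere, and equality in (II), which does not involve g, is characterized by f = 0 alone. *)

theory Defs
  imports "HOL-Analysis.Analysis"
begin

text \<open>Only meant for exponents \<open>r > 0\<close>, where \<open>\<infinity>\<close> to the power \<open>r\<close> is \<open>\<infinity>\<close>.\<close>
definition ennpow :: "ennreal \<Rightarrow> real \<Rightarrow> ennreal" where
  "ennpow x r = (if x = \<infinity> then \<infinity> else ennreal (enn2real x powr r))"

definition ext_hypergeom :: "real \<Rightarrow> real \<Rightarrow> real \<Rightarrow> real \<Rightarrow> real \<Rightarrow> real \<Rightarrow> real" where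
  "ext_hypergeom a b c z P Q =
     1 / Beta b (c - b) *
     (LINT t:{0<..<1}|lborel.
        t powr (b - 1) * (1 - t) powr (c - b - 1) * (1 - z * t) powr (- a)
        * exp (- P / t - Q / (1 - t)))"

definition const_F :: "real \<Rightarrow> real \<Rightarrow> real \<Rightarrow> real \<Rightarrow> real \<Rightarrow> real \<Rightarrow> real \<Rightarrow> real \<Rightarrow> real" where
  "const_F q' s1 s2 \<alpha>1 \<alpha>2 A2 P Q =
     \<alpha>1 powr (A2 - 1 / q')
     * Beta (1 - q' * A2) (s1 + s2 + q' * A2 - 1) powr (1 / q')
     * ext_hypergeom s2 (1 - q' * A2) (s1 + s2) ((\<alpha>1 - \<alpha>2) / \<alpha>1) P Q powr (1 / q')"

definition const_G :: "real \<Rightarrow> real \<Rightarrow> real \<Rightarrow> real \<Rightarrow> real \<Rightarrow> real \<Rightarrow> real \<Rightarrow> real \<Rightarrow> real" where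
  "const_G p' s1 s2 \<alpha>1 \<alpha>2 A1 P Q =
     \<alpha>1 powr (- s1 / p') * \<alpha>2 powr ((1 - s2) / p' - A1)
     * Beta (1 - p' * A1) (s1 + s2 + p' * A1 - 1) powr (1 / p')
     * ext_hypergeom s1 (1 - p' * A1) (s1 + s2) ((\<alpha>1 - \<alpha>2) / \<alpha>1) P Q powr (1 / p')"

definition exp_kernel ::
  "real \<Rightarrow> real \<Rightarrow> real \<Rightarrow> real \<Rightarrow> real \<Rightarrow> real \<Rightarrow> real \<Rightarrow> real \<Rightarrow> real \<Rightarrow> real" where
  "exp_kernel l s1 s2 \<alpha>1 \<alpha>2 pt qt x y =
     exp (- (\<alpha>1 * qt + \<alpha>2 * pt) * (y / x + 1 / (\<alpha>1 * \<alpha>2) * (x / y)))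
     / ((x + \<alpha>1 * y) powr (l * s1) * (x + \<alpha>2 * y) powr (l * s2))"

definition nonneg_measurable :: "(real \<Rightarrow> real) \<Rightarrow> bool" where
  "nonneg_measurable f \<longleftrightarrow> f \<in> borel_measurable (lebesgue_on {0<..}) \<and> (\<forall>x>0. 0 \<le> f x)"

text \<open>All integrals of non-negative functions take values in \<open>[0,\<infinity>]\<close>; no convergence is
  presupposed, and \<open>0 * \<infinity> = 0\<close>.\<close>

definition weighted_norm :: "real \<Rightarrow> real \<Rightarrow> (real \<Rightarrow> real) \<Rightarrow> ennreal" where
  "weighted_norm w r f =
     ennpow (\<integral>\<^sup>+ x. ennreal (x powr w * f x powr r) \<partial>lebesgue_on {0<..}) (1 / r)"

definition bilinear_form ::
  "(real \<Rightarrow> real \<Rightarrow> real) \<Rightarrow> (real \<Rightarrow> real) \<Rightarrow> (real \<Rightarrow> real) \<Rightarrow> ennreal" where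
  "bilinear_form k f g =
     (\<integral>\<^sup>+ y. (\<integral>\<^sup>+ x. ennreal (k x y * f x * g y) \<partial>lebesgue_on {0<..}) \<partial>lebesgue_on {0<..})"

definition transform_norm ::
  "(real \<Rightarrow> real \<Rightarrow> real) \<Rightarrow> real \<Rightarrow> real \<Rightarrow> (real \<Rightarrow> real) \<Rightarrow> ennreal" where
  "transform_norm k w r f =
     ennpow (\<integral>\<^sup>+ y. ennreal (y powr w)
                    * ennpow (\<integral>\<^sup>+ x. ennreal (k x y * f x) \<partial>lebesgue_on {0<..}) r
             \<partial>lebesgue_on {0<..}) (1 / r)"

end

theory Submission
  imports Defs
begin

text \<open>
  Normalising the integrals behind \<open>k(F)\<close> and \<open>k(G)\<close> gives two Markov kernels \<open>a\<close> (in \<open>y\<close>) and \<open>b\<close>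
  (in \<open>x\<close>), both homogeneous of degree \<open>-1\<close>, such that the integrand of (I) equals
  \<open>C * (a W) powr (1 / q') * (b V) powr (1 / p') * (W V) powr (1 - \<lambda>)\<close>, where \<open>W\<close> and \<open>V\<close> are the integrands of the two weighted norms.
  The three-term Hoelder inequality then gives (I). Equality forces \<open>a W = c b V\<close> almost everywhere;
  comparing this at \<open>(x, y)\<close> and \<open>(2 x, 2 y)\<close> shows that \<open>V (2 y)\<close> is a constant multiple of \<open>V y\<close>, and
  such a function has integral \<open>0\<close> or \<open>\<infinity>\<close> over the half-line. Inequality (II) is (I) by duality of
  weighted Lebesgue spaces.
\<close>

section \<open>A three-term Hoelder inequality for Markov kernels\<close>

text \<open>Each of the two densities carries the denominator (x + \<alpha>1 y)^s1 (x + \<alpha>2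
  y)^s2, so the roots of order \<open>q'\<close> and \<open>p'\<close> multiply to the exponents
  \<lambda> s1 and \<lambda> s2. The parameters A1 and A2 enter as powers of y / x in the densities,
  and the weights of the two norms compensate these powers. The third factor contains no kernel. Its
  exponent 1 - \<lambda> is chosen so that W occurs with total exponent 1/q' + 1 - \<lambda> = 1/p
  and V with 1/p' + 1 - \<lambda> = 1/q. Since 1 - \<lambda> may be 0, the equality case can rely
  only on the proportionality of a W and b V, never on W V. The dilation argument exploits this
  without solving for W and V: of the kernels it uses only positivity and the common degree of
  homogeneity. All integrals live in [0, \<infinity>]. Equality is examined only for a finite
  right-hand side, since otherwise \<infinity> = \<infinity> would count as equality.\<close>

lemma weighted_amgm3:
  fixes A B D r s t :: real
  assumes nn: "0 \<le> A" "0 \<le> B" "0 \<le> D" and rst: "0 < r" "0 < s" "0 \<le> t" "r + s + t = 1"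
  shows "A powr r * B powr s * D powr t \<le> r * A + s * B + t * D"
    and "r * A + s * B + t * D \<le> A powr r * B powr s * D powr t \<Longrightarrow> A = B"
proof -
  let ?S = "r * A + s * B + t * D" and ?P = "A powr r * B powr s * D powr t"
  have nnS: "0 \<le> r * A" "0 \<le> s * B" "0 \<le> t * D"
    using nn rst by auto
  have "?P \<le> ?S \<and> (?S \<le> ?P \<longrightarrow> A = B)"
  \<comment> \<open>\<open>0 powr 0\<close> is 0, so for t = 0 and D = 0 the product is 0 rather
    than A^r B^s. The degenerate case is therefore settled separately, without logarithms.\<close>
  proof (cases "A = 0 \<or> B = 0 \<or> D = 0")
    case True
    then have P0: "?P = 0" by auto
    have "A = B" if "?S \<le> 0"
    proof -
      have "r * A = 0" "s * B = 0" using that nnS by linarith+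
      then show ?thesis using rst by auto
    qed
    then show ?thesis unfolding P0 using nnS by linarith
  next
    case False
    then have pos: "0 < A" "0 < B" "0 < D" using nn by auto
    have S: "0 < ?S" using nnS mult_pos_pos[OF rst(1) pos(1)] by linarith
    \<comment> \<open>\<open>d X\<close> is the gap in ln v \<le> v - 1 at v = X / S, where S is the
      weighted sum. Because the weights add up to 1, the weighted gaps add up to ln S - ln P, with P
      the product. This gives P \<le> S, and P = S closes the gaps of A and B, so that A = S = B.
      The weight t may vanish, hence nothing follows for D.\<close>
    define d where "d X = X / ?S - 1 - (ln X - ln ?S)" for X
    have ln_quot: "ln (X / ?S) = ln X - ln ?S" if "0 < X" for X
      using that S by (rule ln_divide_pos)
    have d: "0 \<le> d X" if "0 < X" for X
      using ln_le_minus_one[of "X / ?S"] ln_quot[OF that] that S by (simp add: d_def)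
    have "ln ?P = r * ln A + s * ln B + t * ln D"
      using pos by (simp add: ln_mult ln_powr)
    moreover have "?S / ?S = r * A / ?S + s * B / ?S + t * D / ?S"
      by (simp only: add_divide_distrib)
    moreover have "r * d A + s * d B + t * d D = (r * A / ?S + s * B / ?S + t * D / ?S)
        - (r + s + t) - (r * ln A + s * ln B + t * ln D) + (r + s + t) * ln ?S"
      by (simp add: d_def algebra_simps)
    ultimately have eq: "ln ?S - ln ?P = r * d A + s * d B + t * d D"
      using S rst by simp
    have dd: "0 \<le> r * d A" "0 \<le> s * d B" "0 \<le> t * d D"
      using d pos rst by auto
    have P: "0 < ?P" using pos by simp
    have "A = B" if "?S \<le> ?P"
    proof -
      have "ln ?S \<le> ln ?P" using that S by simp
      then have "r * d A = 0" "s * d B = 0" using eq dd by linarith+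
      then have "ln (A / ?S) = A / ?S - 1" "ln (B / ?S) = B / ?S - 1"
        using rst ln_quot pos by (auto simp: d_def)
      then have "A / ?S = 1" "B / ?S = 1"
        using S pos by (metis divide_pos_pos ln_eq_minus_one)+
      then show ?thesis using S by (simp add: field_simps)
    qed
    moreover have "ln ?P \<le> ln ?S" using eq dd by linarith
    then have "?P \<le> ?S" using P S by simp
    ultimately show ?thesis by blast
  qed
  then show "?P \<le> ?S" and "?S \<le> ?P \<Longrightarrow> A = B" by auto
qed

text \<open>Integrate the weighted inequality of arithmetic and geometric means pointwise. By
  Tonelli each of a W, b V and W V has total mass 1: integrate y first where a occurs, x first where
  b occurs. The bound is then r + s + t = 1. Equality of the integrals makes the two sides agree
  almost everywhere, and the equality case of the pointwise inequality applies.\<close>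

lemma (in pair_sigma_finite) markov_hoelder_normalized:
  fixes a b :: "'a \<Rightarrow> 'b \<Rightarrow> real" and W :: "'a \<Rightarrow> real" and V :: "'b \<Rightarrow> real"
  assumes [measurable]: "case_prod a \<in> borel_measurable (M1 \<Otimes>\<^sub>M M2)"
      "case_prod b \<in> borel_measurable (M1 \<Otimes>\<^sub>M M2)"
      "W \<in> borel_measurable M1" "V \<in> borel_measurable M2"
    and nn: "\<And>x y. x \<in> space M1 \<Longrightarrow> y \<in> space M2 \<Longrightarrow> 0 \<le> a x y"
      "\<And>x y. x \<in> space M1 \<Longrightarrow> y \<in> space M2 \<Longrightarrow> 0 \<le> b x y"
      "\<And>x. x \<in> space M1 \<Longrightarrow> 0 \<le> W x" "\<And>y. y \<in> space M2 \<Longrightarrow> 0 \<le> V y"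
    and a1: "\<And>x. x \<in> space M1 \<Longrightarrow> (\<integral>\<^sup>+ y. ennreal (a x y) \<partial>M2) = 1"
    and b1: "\<And>y. y \<in> space M2 \<Longrightarrow> (\<integral>\<^sup>+ x. ennreal (b x y) \<partial>M1) = 1"
    and W1: "(\<integral>\<^sup>+ x. ennreal (W x) \<partial>M1) = 1" and V1: "(\<integral>\<^sup>+ y. ennreal (V y) \<partial>M2) = 1"
    and rst: "0 < r" "0 < s" "0 \<le> t" "r + s + t = 1"
  defines "I \<equiv> (\<integral>\<^sup>+ y. (\<integral>\<^sup>+ x. ennreal ((a x y * W x) powr r * (b x y * V y) powr s
                  * (W x * V y) powr t) \<partial>M1) \<partial>M2)"
  shows "I \<le> 1" and "I = 1 \<Longrightarrow> AE x in M1. AE y in M2. a x y * W x = b x y * V y"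
proof -
  define A where "A = (\<lambda>(x, y). a x y * W x)"
  define B where "B = (\<lambda>(x, y). b x y * V y)"
  define D where "D = (\<lambda>(x, y). W x * V y)"
  define E where "E z = A z powr r * B z powr s * D z powr t" for z
  define G where "G z = r * A z + s * B z + t * D z" for z
  have [measurable]: "A \<in> borel_measurable (M1 \<Otimes>\<^sub>M M2)" "B \<in> borel_measurable (M1 \<Otimes>\<^sub>M M2)"
    "D \<in> borel_measurable (M1 \<Otimes>\<^sub>M M2)"
    unfolding A_def B_def D_def by measurable
  have [measurable]: "E \<in> borel_measurable (M1 \<Otimes>\<^sub>M M2)" "G \<in> borel_measurable (M1 \<Otimes>\<^sub>M M2)"
    unfolding E_def[abs_def] G_def[abs_def] by measurable
  have nnz: "0 \<le> A z" "0 \<le> B z" "0 \<le> D z" if "z \<in> space (M1 \<Otimes>\<^sub>M M2)" for z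
    using that nn by (auto simp: A_def B_def D_def space_pair_measure)
  have I: "I = (\<integral>\<^sup>+ z. ennreal (E z) \<partial>(M1 \<Otimes>\<^sub>M M2))"
    unfolding I_def by (subst nn_integral_snd[symmetric]) (auto simp: E_def A_def B_def D_def)
  have "(\<integral>\<^sup>+ z. ennreal (A z) \<partial>(M1 \<Otimes>\<^sub>M M2)) = (\<integral>\<^sup>+ x. (\<integral>\<^sup>+ y. ennreal (a x y) * ennreal (W x) \<partial>M2) \<partial>M1)"
    by (subst M2.nn_integral_fst[symmetric])
       (auto simp: A_def ennreal_mult nn intro!: nn_integral_cong)
  also have "\<dots> = (\<integral>\<^sup>+ x. ennreal (W x) \<partial>M1)"
    by (intro nn_integral_cong) (simp add: nn_integral_multc a1)
  finally have A1: "(\<integral>\<^sup>+ z. ennreal (A z) \<partial>(M1 \<Otimes>\<^sub>M M2)) = 1" by (simp add: W1)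
  have "(\<integral>\<^sup>+ z. ennreal (B z) \<partial>(M1 \<Otimes>\<^sub>M M2)) = (\<integral>\<^sup>+ y. (\<integral>\<^sup>+ x. ennreal (b x y) * ennreal (V y) \<partial>M1) \<partial>M2)"
    by (subst nn_integral_snd[symmetric])
       (auto simp: B_def ennreal_mult nn intro!: nn_integral_cong)
  also have "\<dots> = (\<integral>\<^sup>+ y. ennreal (V y) \<partial>M2)"
    by (intro nn_integral_cong) (simp add: nn_integral_multc b1)
  finally have B1: "(\<integral>\<^sup>+ z. ennreal (B z) \<partial>(M1 \<Otimes>\<^sub>M M2)) = 1" by (simp add: V1)
  have "(\<integral>\<^sup>+ z. ennreal (D z) \<partial>(M1 \<Otimes>\<^sub>M M2)) = (\<integral>\<^sup>+ y. (\<integral>\<^sup>+ x. ennreal (W x) * ennreal (V y) \<partial>M1) \<partial>M2)"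
    by (subst nn_integral_snd[symmetric])
       (auto simp: D_def ennreal_mult nn intro!: nn_integral_cong)
  then have D1: "(\<integral>\<^sup>+ z. ennreal (D z) \<partial>(M1 \<Otimes>\<^sub>M M2)) = 1"
    by (simp add: nn_integral_multc W1 V1)
  have "(\<integral>\<^sup>+ z. ennreal (G z) \<partial>(M1 \<Otimes>\<^sub>M M2))
      = (\<integral>\<^sup>+ z. ennreal r * ennreal (A z) + ennreal s * ennreal (B z) + ennreal t * ennreal (D z) \<partial>(M1 \<Otimes>\<^sub>M M2))"
    using rst nnz by (intro nn_integral_cong) (simp add: G_def ennreal_mult ennreal_plus)
  also have "\<dots> = ennreal r + ennreal s + ennreal t"
    by (simp add: nn_integral_add nn_integral_cmult A1 B1 D1)
  also have "\<dots> = 1"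
    using rst by (simp flip: ennreal_plus)
  finally have G1: "(\<integral>\<^sup>+ z. ennreal (G z) \<partial>(M1 \<Otimes>\<^sub>M M2)) = 1" .
  have le: "ennreal (E z) \<le> ennreal (G z)" if "z \<in> space (M1 \<Otimes>\<^sub>M M2)" for z
    unfolding E_def G_def using nnz[OF that] rst by (intro ennreal_leI weighted_amgm3(1)) auto
  show I1: "I \<le> 1"
    unfolding I G1[symmetric] by (intro nn_integral_mono le)
  assume eq: "I = 1"
  \<comment> \<open>Strict monotonicity of the integral requires the smaller integral to be finite;
    here it is 1.\<close>
  have "AE z in M1 \<Otimes>\<^sub>M M2. ennreal (G z) \<le> ennreal (E z)"
  proof (rule ccontr)
    assume "\<not> ?thesis"
    then have "(\<integral>\<^sup>+ z. ennreal (E z) \<partial>(M1 \<Otimes>\<^sub>M M2)) < (\<integral>\<^sup>+ z. ennreal (G z) \<partial>(M1 \<Otimes>\<^sub>M M2))"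
      using eq I le by (intro nn_integral_less) auto
    then show False using eq I G1 by simp
  qed
  then have "AE z in M1 \<Otimes>\<^sub>M M2. A z = B z"
  proof (rule AE_mp, intro AE_I2 impI)
    fix z assume z: "z \<in> space (M1 \<Otimes>\<^sub>M M2)" "ennreal (G z) \<le> ennreal (E z)"
    then have "G z \<le> E z"
      using nnz[OF z(1)] by (subst (asm) ennreal_le_iff) (auto simp: E_def)
    then show "A z = B z"
      unfolding G_def E_def by (rule weighted_amgm3(2)[OF nnz[OF z(1)] rst])
  qed
  then show "AE x in M1. AE y in M2. a x y * W x = b x y * V y"
    by (drule_tac AE_pair) (simp add: A_def B_def)
qed

text \<open>Scaling to the normalized case: W occurs with total exponent r + t and V with s + t,
  which yields the powers of the masses m and n.\<close>

lemma (in pair_sigma_finite) markov_hoelder: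
  fixes a b :: "'a \<Rightarrow> 'b \<Rightarrow> real" and W :: "'a \<Rightarrow> real" and V :: "'b \<Rightarrow> real"
  assumes [measurable]: "case_prod a \<in> borel_measurable (M1 \<Otimes>\<^sub>M M2)"
      "case_prod b \<in> borel_measurable (M1 \<Otimes>\<^sub>M M2)"
      "W \<in> borel_measurable M1" "V \<in> borel_measurable M2"
    and nn: "\<And>x y. x \<in> space M1 \<Longrightarrow> y \<in> space M2 \<Longrightarrow> 0 \<le> a x y"
      "\<And>x y. x \<in> space M1 \<Longrightarrow> y \<in> space M2 \<Longrightarrow> 0 \<le> b x y"
      "\<And>x. x \<in> space M1 \<Longrightarrow> 0 \<le> W x" "\<And>y. y \<in> space M2 \<Longrightarrow> 0 \<le> V y"
    and a1: "\<And>x. x \<in> space M1 \<Longrightarrow> (\<integral>\<^sup>+ y. ennreal (a x y) \<partial>M2) = 1"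
    and b1: "\<And>y. y \<in> space M2 \<Longrightarrow> (\<integral>\<^sup>+ x. ennreal (b x y) \<partial>M1) = 1"
    and W1: "(\<integral>\<^sup>+ x. ennreal (W x) \<partial>M1) = ennreal m" and V1: "(\<integral>\<^sup>+ y. ennreal (V y) \<partial>M2) = ennreal n"
    and mn: "0 < m" "0 < n"
    and rst: "0 < r" "0 < s" "0 \<le> t" "r + s + t = 1"
  defines "I \<equiv> (\<integral>\<^sup>+ y. (\<integral>\<^sup>+ x. ennreal ((a x y * W x) powr r * (b x y * V y) powr s
                  * (W x * V y) powr t) \<partial>M1) \<partial>M2)"
  shows "I \<le> ennreal (m powr (r + t) * n powr (s + t))"
    and "I = ennreal (m powr (r + t) * n powr (s + t)) \<Longrightarrow>
      AE x in M1. AE y in M2. a x y * (W x / m) = b x y * (V y / n)"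
proof -
  let ?c = "m powr (r + t) * n powr (s + t)"
  let ?E = "\<lambda>x y. (a x y * (W x / m)) powr r * (b x y * (V y / n)) powr s * (W x / m * (V y / n)) powr t"
  have c: "0 < ?c" using mn by simp
  have Wm: "(\<integral>\<^sup>+ x. ennreal (W x / m) \<partial>M1) = 1"
    using mn by (simp add: divide_ennreal[symmetric] nn nn_integral_divide W1 ennreal_divide_self cong: nn_integral_cong)
  have Vn: "(\<integral>\<^sup>+ y. ennreal (V y / n) \<partial>M2) = 1"
    using mn by (simp add: divide_ennreal[symmetric] nn nn_integral_divide V1 ennreal_divide_self cong: nn_integral_cong)
  have E: "(a x y * W x) powr r * (b x y * V y) powr s * (W x * V y) powr t = ?c * ?E x y"
    if "x \<in> space M1" "y \<in> space M2" for x y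
    using that mn nn by (simp add: powr_mult powr_divide powr_add field_simps)
  have nnE: "0 \<le> ?E x y" for x y by simp
  have "I = (\<integral>\<^sup>+ y. (\<integral>\<^sup>+ x. ennreal ?c * ennreal (?E x y) \<partial>M1) \<partial>M2)"
    unfolding I_def
  proof (intro nn_integral_cong)
    fix x y assume "x \<in> space M1" "y \<in> space M2"
    from E[OF this] show "ennreal ((a x y * W x) powr r * (b x y * V y) powr s
                  * (W x * V y) powr t) = ennreal ?c * ennreal (?E x y)"
      using c nnE by (simp only: ennreal_mult less_imp_le)
  qed
  also have "\<dots> = (\<integral>\<^sup>+ y. ennreal ?c * (\<integral>\<^sup>+ x. ennreal (?E x y) \<partial>M1) \<partial>M2)"
    by (intro nn_integral_cong nn_integral_cmult) measurable
  also have "\<dots> = ennreal ?c * (\<integral>\<^sup>+ y. (\<integral>\<^sup>+ x. ennreal (?E x y) \<partial>M1) \<partial>M2)"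
    by (intro nn_integral_cmult) measurable
  finally have I: "I = ennreal ?c * (\<integral>\<^sup>+ y. (\<integral>\<^sup>+ x. ennreal (?E x y) \<partial>M1) \<partial>M2)" .
  have "(\<integral>\<^sup>+ y. (\<integral>\<^sup>+ x. ennreal (?E x y) \<partial>M1) \<partial>M2) \<le> 1"
    using mn rst by (intro markov_hoelder_normalized(1)) (auto simp: nn a1 b1 Wm Vn)
  then show "I \<le> ennreal ?c"
    unfolding I using mult_left_mono[of _ 1 "ennreal ?c"] by auto
  assume "I = ennreal ?c"
  then have "(\<integral>\<^sup>+ y. (\<integral>\<^sup>+ x. ennreal (?E x y) \<partial>M1) \<partial>M2) = 1"
    unfolding I using ennreal_mult_cancel_left[of "ennreal ?c" _ 1] mn by auto
  then show "AE x in M1. AE y in M2. a x y * (W x / m) = b x y * (V y / n)"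
    using mn rst by (intro markov_hoelder_normalized(2)[where r=r and s=s and t=t]) (auto simp: nn a1 b1 Wm Vn)
qed

section \<open>Dilations of the half-line\<close>

abbreviation half_line :: "real measure" where
  "half_line \<equiv> restrict_space lborel {0<..}"

lemma nn_integral_half_line:
  "(\<integral>\<^sup>+ x. h x \<partial>half_line) = (\<integral>\<^sup>+ x. h x * indicator {0<..} x \<partial>lborel)"
  by (rule nn_integral_restrict_space) simp

lemma AE_half_line: "(AE x in half_line. Q x) \<longleftrightarrow> (AE x in lborel. 0 < x \<longrightarrow> Q x)"
  by (subst AE_restrict_space_iff) auto

lemma measurable_half_line [measurable_dest]:
  "h \<in> borel_measurable borel \<Longrightarrow> h \<in> borel_measurable half_line"
  by (simp add: measurable_restrict_space1)

lemma nn_integral_half_line_scale: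
  assumes [measurable]: "h \<in> borel_measurable borel" and c: "0 < c"
  shows "(\<integral>\<^sup>+ x. h x \<partial>half_line) = ennreal c * (\<integral>\<^sup>+ x. h (c * x) \<partial>half_line)"
  unfolding nn_integral_half_line
  by (subst nn_integral_real_affine[where c=c and t=0])
     (use c in \<open>auto simp: indicator_def zero_less_mult_iff intro!: arg_cong2[where f="(*)"] nn_integral_cong\<close>)

lemma AE_half_line_scale:
  assumes "AE x in half_line. Q x" and c: "0 < c"
  shows "AE x in half_line. Q (c * x)"
proof -
  \<comment> \<open>\<open>Q\<close> need not define a measurable set, so the dilation is applied to
    a Borel null set containing the exceptional points.\<close>
  from assms(1) obtain N where N: "N \<in> sets lborel" "emeasure lborel N = 0" "{x. \<not> (0 < x \<longrightarrow> Q x)} \<subseteq> N"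
    unfolding AE_half_line unfolding eventually_ae_filter null_sets_def by auto
  then have "AE x in lborel. x \<notin> N"
    by (intro AE_not_in) (auto simp: null_sets_def)
  then have "AE x in lborel. 0 + c * x \<notin> N"
    using N c by (intro AE_borel_affine) auto
  then show ?thesis
    unfolding AE_half_line
  proof (rule AE_mp, intro AE_I2 impI)
    fix x assume "0 + c * x \<notin> N" "0 < x"
    moreover have "0 < c * x" using \<open>0 < x\<close> c by simp
    ultimately show "Q (c * x)" using N(3) by auto
  qed
qed

text \<open>The substitution x to 2 x multiplies the integral by 2 c, so a finite nonzero integral
  forces 2 c = 1. Then (0, 2 r) and (0, r) carry the same finite mass, and cancellation leaves no
  mass on [r, 2 r) for any r > 0.\<close>

lemma nn_integral_self_similar:
  fixes V :: "real \<Rightarrow> real"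
  assumes [measurable]: "V \<in> borel_measurable borel" and nn: "\<And>x. 0 \<le> V x"
    and c: "0 \<le> c" and sim: "AE x in half_line. V (2 * x) = c * V x"
    and fin: "(\<integral>\<^sup>+ x. ennreal (V x) \<partial>half_line) < \<infinity>"
  shows "AE x in half_line. V x = 0"
proof -
  let ?I = "\<lambda>A. (\<integral>\<^sup>+ x. ennreal (V x) * indicator A x \<partial>half_line)"
  have scale: "?I A = ennreal (2 * c) * ?I {x. 2 * x \<in> A}" if [measurable]: "A \<in> sets borel" for A
  proof -
    have [measurable]: "{x. 2 * x \<in> A} \<in> sets borel"
      by measurable
    have "?I A = ennreal 2 * (\<integral>\<^sup>+ x. ennreal (V (2 * x)) * indicator A (2 * x) \<partial>half_line)"
      by (rule nn_integral_half_line_scale) auto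
    also have "(\<integral>\<^sup>+ x. ennreal (V (2 * x)) * indicator A (2 * x) \<partial>half_line)
        = (\<integral>\<^sup>+ x. ennreal c * (ennreal (V x) * indicator {x. 2 * x \<in> A} x) \<partial>half_line)"
      using sim
      by (intro nn_integral_cong_AE, elim AE_mp, intro AE_I2)
         (auto simp: ennreal_mult c nn indicator_def)
    also have "\<dots> = ennreal c * ?I {x. 2 * x \<in> A}"
      by (rule nn_integral_cmult) (rule measurable_half_line, measurable)
    finally show ?thesis using c by (simp add: ennreal_mult mult.assoc)
  qed
  have meas: "(\<lambda>x. ennreal (V x) * indicator A x) \<in> borel_measurable half_line"
    if [measurable]: "A \<in> sets borel" for A
    by (rule measurable_half_line) measurable
  have finA: "?I A < \<infinity>" for A
    by (rule le_less_trans[OF nn_integral_mono fin]) (auto simp: indicator_def)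
  show ?thesis
  proof (cases "?I UNIV = 0")
    case True
    then have "AE x in half_line. ennreal (V x) * indicator UNIV x = 0"
      by (subst (asm) nn_integral_0_iff_AE) (rule measurable_half_line, measurable)
    then show ?thesis by (rule AE_mp) (auto simp: nn)
  next
    case False
    have "?I UNIV = ennreal (2 * c) * ?I UNIV"
      using scale[of UNIV] by simp
    moreover have "?I UNIV < \<infinity>" by (rule finA)
    ultimately have c2: "ennreal (2 * c) = 1"
      using False ennreal_mult_cancel_left[of "?I UNIV" "ennreal (2 * c)" 1]
      by (auto simp: mult.commute)
    have "AE x in half_line. x \<in> {r..<2*r} \<longrightarrow> V x = 0" if r: "0 < r" for r
    proof -
      have "?I {..<2 * r} = ?I {..<r}"
        using scale[of "{..<2 * r}"] by (simp add: c2 lessThan_def)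
      moreover have "?I {..<2 * r} = (\<integral>\<^sup>+ x. ennreal (V x) * indicator {..<r} x
          + ennreal (V x) * indicator {r..<2 * r} x \<partial>half_line)"
        using r by (intro nn_integral_cong) (auto simp: indicator_def)
      moreover have "\<dots> = ?I {..<r} + ?I {r..<2 * r}"
        by (intro nn_integral_add meas) auto
      ultimately have "?I {..<r} + ?I {r..<2 * r} = ?I {..<r} + 0"
        by simp
      then have "?I {r..<2 * r} = 0"
        using finA[of "{..<r}"] by (subst (asm) ennreal_add_left_cancel) auto
      then have "AE x in half_line. ennreal (V x) * indicator {r..<2 * r} x = 0"
        by (subst (asm) nn_integral_0_iff_AE) (rule measurable_half_line, measurable)
      then show ?thesis by (rule AE_mp) (auto simp: nn indicator_def split: if_splits)
    qed
    \<comment> \<open>Countably many dyadic shells cover the half-line; x lies in the one with k =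
      \<lfloor>log 2 x\<rfloor>.\<close>
    then have "AE x in half_line. \<forall>k::int. x \<in> {2 powr k..<2 * 2 powr k} \<longrightarrow> V x = 0"
      by (subst AE_all_countable) auto
    then show ?thesis
    proof (rule AE_mp, intro AE_I2 impI)
      fix x :: real
      assume x: "x \<in> space half_line" and *: "\<forall>k::int. x \<in> {2 powr k..<2 * 2 powr k} \<longrightarrow> V x = 0"
      then have "0 < x" by (simp add: space_restrict_space)
      then have "2 powr \<lfloor>log 2 x\<rfloor> \<le> x \<and> x < 2 powr (\<lfloor>log 2 x\<rfloor> + 1)"
        using floor_log_eq_powr_iff[of x 2 "\<lfloor>log 2 x\<rfloor>"] by simp
      then show "V x = 0"
        using * by (auto simp: powr_add intro!: *[rule_format, of "\<lfloor>log 2 x\<rfloor>"])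
    qed
  qed
qed

text \<open>Dividing the hypothesis at \<open>(2 x, 2 y)\<close> by the one at \<open>(x, y)\<close> cancels the kernels.\<close>

lemma homogeneous_kernels_proportional:
  fixes a b :: "real \<Rightarrow> real \<Rightarrow> real" and W V :: "real \<Rightarrow> real"
  assumes [measurable]: "V \<in> borel_measurable borel" and nn: "\<And>x. 0 \<le> W x" "\<And>y. 0 \<le> V y"
    and pos: "\<And>x y. 0 < x \<Longrightarrow> 0 < y \<Longrightarrow> 0 < a x y" "\<And>x y. 0 < x \<Longrightarrow> 0 < y \<Longrightarrow> 0 < b x y"
    and hom: "\<And>x y. 0 < x \<Longrightarrow> 0 < y \<Longrightarrow> a (2 * x) (2 * y) = a x y / 2"
      "\<And>x y. 0 < x \<Longrightarrow> 0 < y \<Longrightarrow> b (2 * x) (2 * y) = b x y / 2"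
    and eq: "AE x in half_line. AE y in half_line. a x y * W x = b x y * V y"
    and fin: "(\<integral>\<^sup>+ y. ennreal (V y) \<partial>half_line) < \<infinity>"
  shows "(AE x in half_line. W x = 0) \<or> (AE y in half_line. V y = 0)"
proof (rule disjCI)
  assume V: "\<not> (AE y in half_line. V y = 0)"
  show "AE x in half_line. W x = 0"
    using eq AE_half_line_scale[OF eq, of 2, simplified] AE_space
  proof eventually_elim
    case (elim x)
    show "W x = 0"
    proof (rule ccontr)
      assume "W x \<noteq> 0"
      then have W: "0 < W x" using nn(1)[of x] by simp
      have x: "0 < x" using elim(3) by (simp add: space_restrict_space)
      have "AE y in half_line. a (2 * x) (2 * y) * W (2 * x) = b (2 * x) (2 * y) * V (2 * y)"
        using AE_half_line_scale[OF elim(2), of 2] by simp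
      \<comment> \<open>One fixed x with W x > 0 is enough: W (2 x) / W x does not depend on y and
        serves as the constant of self-similarity of V.\<close>
      with elim(1) AE_space have "AE y in half_line. V (2 * y) = W (2 * x) / W x * V y"
      proof eventually_elim
        case (elim y)
        then have y: "0 < y" by (simp add: space_restrict_space)
        have "a x y * W (2 * x) = b x y * V (2 * y)"
          using elim(3) hom[OF x y] by simp
        then have "b x y * (V (2 * y) * W x) = (a x y * W x) * W (2 * x)"
          by (simp add: algebra_simps)
        also have "\<dots> = b x y * (W (2 * x) * V y)"
          using elim(1) by simp
        finally show ?case
          using W pos(2)[OF x y] by (simp add: field_simps)
      qed
      then have "AE y in half_line. V y = 0"
        using nn by (intro nn_integral_self_similar[where c="W (2 * x) / W x"] fin) auto
      with V show False by simp
    qed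
  qed
qed

section \<open>The extended hypergeometric function as an integral over the half-line\<close>

text \<open>The integrand of \<^const>\<open>ext_hypergeom\<close> after the substitution \<open>u = t / (1 - t)\<close>.\<close>

definition gauss_density :: "real \<Rightarrow> real \<Rightarrow> real \<Rightarrow> real \<Rightarrow> real \<Rightarrow> real \<Rightarrow> real \<Rightarrow> real" where
  "gauss_density a b c z P Q u =
     u powr (b - 1) * (1 + u) powr (a - c) * (1 + (1 - z) * u) powr (- a)
     * exp (- P * (1 + 1 / u) - Q * (1 + u))"

lemma gauss_density_pos:
  assumes "0 < u" "z < 1"
  shows "0 < gauss_density a b c z P Q u"
proof -
  have "0 < 1 + (1 - z) * u" using assms by (intro add_pos_pos) auto
  then show ?thesis using assms by (simp add: gauss_density_def)
qed

lemma ln_gauss_density: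
  assumes "0 < u" "z < 1"
  shows "ln (gauss_density a b c z P Q u) = (b - 1) * ln u + (a - c) * ln (1 + u)
    - a * ln (1 + (1 - z) * u) - P * (1 + 1 / u) - Q * (1 + u)"
proof -
  have "0 < 1 + (1 - z) * u" using assms by (intro add_pos_pos) auto
  then show ?thesis using assms by (simp add: gauss_density_def ln_mult ln_powr)
qed

lemma gauss_density_nonneg: "0 \<le> gauss_density a b c z P Q u"
  by (simp add: gauss_density_def)

lemma borel_measurable_gauss_density [measurable]:
  "gauss_density a b c z P Q \<in> borel_measurable borel"
  unfolding gauss_density_def[abs_def] by measurable

text \<open>For 0 < t < 1 the number 1 - z t is a convex combination of 1 and 1 - z, both positive,
  so its power is bounded. The exponential is at most 1, and a multiple of the Beta integrand
  dominates.\<close>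

lemma set_integrable_ext_hypergeom:
  fixes a b c z P Q :: real
  assumes b: "0 < b" "b < c" and z: "z < 1" and PQ: "0 \<le> P" "0 \<le> Q"
  shows "set_integrable lborel {0<..<1} (\<lambda>t. t powr (b - 1) * (1 - t) powr (c - b - 1)
           * (1 - z * t) powr (- a) * exp (- P / t - Q / (1 - t)))"
proof -
  define m where "m = min 1 (1 - z)"
  define M where "M = max 1 (1 - z)"
  \<comment> \<open>The sum of both endpoint powers covers a \<ge> 0 and a < 0 at once.\<close>
  define C where "C = m powr (- a) + M powr (- a)"
  have mM: "0 < m" "m \<le> M" using z by (auto simp: m_def M_def)
  have "set_integrable lborel {0<..<1} (\<lambda>t. t powr (b - 1) * (1 - t) powr ((c - b) - 1))"
    by (rule set_integrable_subset[OF integrable_Beta]) (use b in auto)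
  then have "set_integrable lborel {0<..<1} (\<lambda>t. C * (t powr (b - 1) * (1 - t) powr (c - b - 1)))"
    by (rule set_integrable_mult_right)
  then show ?thesis
  proof (rule set_integrable_bound)
    show "AE t in lborel. t \<in> {0<..<1} \<longrightarrow>
      norm (t powr (b - 1) * (1 - t) powr (c - b - 1) * (1 - z * t) powr (- a) * exp (- P / t - Q / (1 - t)))
      \<le> norm (C * (t powr (b - 1) * (1 - t) powr (c - b - 1)))"
    proof (intro AE_I2 impI)
      fix t :: real assume t: "t \<in> {0<..<1}"
      have eq: "1 - z * t = (1 - t) * 1 + t * (1 - z)" by (simp add: algebra_simps)
      have "m = (1 - t) * m + t * m" by (simp add: algebra_simps)
      also have "\<dots> \<le> 1 - z * t"
        unfolding eq using t by (intro add_mono mult_left_mono) (auto simp: m_def)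
      finally have lo: "m \<le> 1 - z * t" .
      have "1 - z * t \<le> (1 - t) * M + t * M"
        unfolding eq using t by (intro add_mono mult_left_mono) (auto simp: M_def)
      also have "\<dots> = M" by (simp add: algebra_simps)
      finally have hi: "1 - z * t \<le> M" .
      have "(1 - z * t) powr (- a) \<le> C"
      proof (cases "0 \<le> a")
        case True
        then have "(1 - z * t) powr (- a) \<le> m powr (- a)"
          using lo mM by (intro powr_mono2') auto
        then show ?thesis by (simp add: C_def add_increasing2)
      next
        case False
        then have "(1 - z * t) powr (- a) \<le> M powr (- a)"
          using lo hi mM by (intro powr_mono2) auto
        then show ?thesis by (simp add: C_def add_increasing)
      qed
      moreover have "0 \<le> P / t" "0 \<le> Q / (1 - t)" using t PQ by auto
      then have "exp (- P / t - Q / (1 - t)) \<le> 1"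
        by (simp add: algebra_simps)
      ultimately have "(1 - z * t) powr (- a) * exp (- P / t - Q / (1 - t)) \<le> C * 1"
        by (intro mult_mono) (auto simp: C_def)
      then have "t powr (b - 1) * (1 - t) powr (c - b - 1) * ((1 - z * t) powr (- a) * exp (- P / t - Q / (1 - t)))
          \<le> t powr (b - 1) * (1 - t) powr (c - b - 1) * C"
        by (intro mult_left_mono) auto
      moreover have "0 \<le> C" by (simp add: C_def)
      ultimately show "norm (t powr (b - 1) * (1 - t) powr (c - b - 1) * (1 - z * t) powr (- a) * exp (- P / t - Q / (1 - t)))
      \<le> norm (C * (t powr (b - 1) * (1 - t) powr (c - b - 1)))"
        by (simp add: abs_mult mult_ac)
    qed
  qed (auto simp: set_borel_measurable_def)
qed

lemma Beta_real_pos: "0 < a \<Longrightarrow> 0 < b \<Longrightarrow> 0 < Beta a (b :: real)"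
  by (simp add: Beta_def Gamma_real_pos)

text \<open>The integrand is strictly positive on the unit interval, so a vanishing integral would
  make that interval a null set.\<close>

lemma ext_hypergeom_pos:
  fixes a b c z P Q :: real
  assumes b: "0 < b" "b < c" and z: "z < 1" and PQ: "0 \<le> P" "0 \<le> Q"
  shows "0 < ext_hypergeom a b c z P Q"
proof -
  let ?f = "\<lambda>t. t powr (b - 1) * (1 - t) powr (c - b - 1) * (1 - z * t) powr (- a) * exp (- P / t - Q / (1 - t))"
  have pos: "0 < ?f t" if "t \<in> {0<..<1}" for t
  proof -
    have "z * t < 1"
      using that mult_strict_right_mono[OF z, of t] by (smt (verit) greaterThanLessThan_iff)
    then show ?thesis using that by simp
  qed
  have "(LINT t:{0<..<1}|lborel. ?f t) \<noteq> 0"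
  proof
    assume "(LINT t:{0<..<1}|lborel. ?f t) = 0"
    then have "AE t in lborel. indicator {0<..<1} t *\<^sub>R ?f t = 0"
      using set_integrable_ext_hypergeom[OF assms, of a] pos
      unfolding set_lebesgue_integral_def set_integrable_def
      by (subst (asm) integral_nonneg_eq_0_iff_AE) (auto simp: indicator_def less_imp_le)
    then have "AE t in lborel. t \<notin> {0<..<1::real}"
      by (rule AE_mp) (use pos in \<open>fastforce simp: indicator_def\<close>)
    then have "emeasure lborel {0<..<1::real} = 0"
      by (subst (asm) AE_iff_null_sets[symmetric]) (auto dest: null_setsD1)
    then show False by simp
  qed
  moreover have "0 \<le> (LINT t:{0<..<1}|lborel. ?f t)"
    unfolding set_lebesgue_integral_def using pos
    by (intro integral_nonneg_AE AE_I2) (auto simp: indicator_def less_imp_le)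
  moreover have "0 < Beta b (c - b)"
    using b by (intro Beta_real_pos) auto
  ultimately show ?thesis unfolding ext_hypergeom_def by simp
qed

text \<open>With u = t / (1 - t) one has 1 + u = 1 / (1 - t), 1 + (1 - z) u = (1 - z t) / (1 - t), 1
  + 1 / u = 1 / t and du = dt / (1 - t)^2. The powers of 1 - t collect to the exponent c - b - 1.
  The Beta factor undoes the normalization of the hypergeometric function.\<close>

lemma nn_integral_gauss_density:
  fixes a b c z P Q :: real
  assumes b: "0 < b" "b < c" and z: "z < 1" and PQ: "0 \<le> P" "0 \<le> Q"
  shows "(\<integral>\<^sup>+ u. ennreal (gauss_density a b c z P Q u) \<partial>half_line)
    = ennreal (Beta b (c - b) * ext_hypergeom a b c z P Q)"
proof -
  let ?f = "\<lambda>t. t powr (b - 1) * (1 - t) powr (c - b - 1) * (1 - z * t) powr (- a) * exp (- P / t - Q / (1 - t))"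
  let ?g = "\<lambda>t::real. t / (1 - t)" and ?g' = "\<lambda>t::real. 1 / (1 - t)\<^sup>2"
  let ?d = "gauss_density a b c z P Q"
  have eq: "?d (?g t) * ?g' t = ?f t" if t: "0 < t" "t < 1" for t
  proof -
    define s where "s = 1 - t"
    have s: "0 < s" "t = 1 - s" using t by (auto simp: s_def)
    have zt: "0 < 1 - z * t"
      using t mult_strict_right_mono[OF z, of t] by linarith
    have 1: "1 + t / s = 1 / s" "1 + (1 - z) * (t / s) = (1 - z * t) / s" "1 + 1 / (t / s) = 1 / t"
      using s t by (auto simp: field_simps)
    have 2: "(t / s) powr (b - 1) = t powr (b - 1) * s powr (- (b - 1))"
      "(1 / s) powr (a - c) = s powr (- (a - c))"
      "((1 - z * t) / s) powr (- a) = (1 - z * t) powr (- a) * s powr a"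
      "1 / s\<^sup>2 = s powr (- 2)"
      using s(1) t zt by (simp_all only: powr_divide powr_minus_divide powr_one_eq_one) (simp_all add: powr_minus_divide)
    have "?d (?g t) * ?g' t = t powr (b - 1) * (1 - z * t) powr (- a) * exp (- P / t - Q / s)
        * (s powr (- (b - 1)) * s powr (- (a - c)) * s powr a * s powr (- 2))"
      unfolding gauss_density_def s_def[symmetric] 1 2 by simp
    also have "s powr (- (b - 1)) * s powr (- (a - c)) * s powr a * s powr (- 2) = s powr (c - b - 1)"
      by (simp flip: powr_add)
    finally show ?thesis by (simp add: s_def mult_ac)
  qed
  have fint: "set_integrable lborel {0<..<1} ?f"
    by (rule set_integrable_ext_hypergeom[OF assms])
  have fg: "set_integrable lborel (einterval (ereal 0) (ereal 1)) (\<lambda>t. ?d (?g t) * ?g' t)"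
    using fint eq by (subst set_integrable_cong[OF refl refl]) auto
  have deriv: "DERIV ?g x :> ?g' x" if "ereal 0 < ereal x" "ereal x < ereal 1" for x
    using that by (auto intro!: derivative_eq_intros simp: field_simps power2_eq_square)
  have cont: "isCont ?d (?g x)" if "ereal 0 < ereal x" "ereal x < ereal 1" for x
  proof -
    have u: "0 < ?g x" using that by simp
    then have "0 < 1 + (1 - z) * ?g x" using z by (intro add_pos_pos mult_pos_pos) auto
    with u show ?thesis
      unfolding gauss_density_def[abs_def] by (intro continuous_intros) auto
  qed
  have cont': "isCont ?g' x" if "ereal 0 < ereal x" "ereal x < ereal 1" for x
    using that by (intro continuous_intros) auto
  have nn: "0 \<le> ?d (?g x)" if "ereal 0 < ereal x" "ereal x < ereal 1" for x
    using that z by (intro less_imp_le gauss_density_pos) auto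
  have nn': "0 \<le> ?g' x" if "ereal 0 \<le> ereal x" "ereal x \<le> ereal 1" for x
    by simp
  have lim0: "((ereal \<circ> ?g \<circ> real_of_ereal) \<longlongrightarrow> ereal 0) (at_right (ereal 0))"
    unfolding ereal_tendsto_simps1 unfolding comp_def lim_ereal by real_asymp
  have lim1: "((ereal \<circ> ?g \<circ> real_of_ereal) \<longlongrightarrow> \<infinity>) (at_left (ereal 1))"
    unfolding ereal_tendsto_simps1 unfolding comp_def tendsto_PInfty_eq_at_top by real_asymp
  \<comment> \<open>This substitution rule delivers integrability of the density on the half-line as
    well as the value. The former is used to pass from the Bochner integral to the non-negative
    one.\<close>
  note sub = interval_integral_substitution_nonneg[OF _ deriv cont cont' nn nn' lim0 lim1 fg]
  have "set_integrable lborel (einterval (ereal 0) \<infinity>) ?d"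
    by (rule sub) simp
  then have int: "integrable lborel (\<lambda>u. indicator {0<..} u * ?d u)"
    by (simp add: set_integrable_def)
  have "(LBINT x=ereal 0..\<infinity>. ?d x) = (LBINT t=ereal 0..ereal 1. ?d (?g t) * ?g' t)"
    by (rule sub) simp
  then have "(LBINT u:{0<..}. ?d u) = (LBINT t:{0<..<1}. ?d (?g t) * ?g' t)"
    by (simp add: interval_lebesgue_integral_def)
  also have "\<dots> = (LBINT t:{0<..<1}. ?f t)"
    using eq by (intro set_lebesgue_integral_cong) auto
  also have "\<dots> = Beta b (c - b) * ext_hypergeom a b c z P Q"
    using Beta_real_pos[of b "c - b"] b by (simp add: ext_hypergeom_def)
  finally have LB: "(\<integral>u. indicator {0<..} u * ?d u \<partial>lborel) = Beta b (c - b) * ext_hypergeom a b c z P Q"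
    by (simp add: set_lebesgue_integral_def)
  have "(\<integral>\<^sup>+ u. ennreal (?d u) \<partial>half_line) = (\<integral>\<^sup>+ u. ennreal (indicator {0<..} u * ?d u) \<partial>lborel)"
    by (subst nn_integral_restrict_space) (auto intro!: nn_integral_cong simp: indicator_def)
  also have "\<dots> = ennreal (\<integral>u. indicator {0<..} u * ?d u \<partial>lborel)"
    by (rule nn_integral_eq_integral[OF int]) (simp add: gauss_density_nonneg)
  also have "\<dots> = ennreal (Beta b (c - b) * ext_hypergeom a b c z P Q)"
    unfolding LB ..
  finally show ?thesis .
qed

section \<open>Duality of weighted norms\<close>

lemma ennpow_ennreal: "0 \<le> x \<Longrightarrow> ennpow (ennreal x) r = ennreal (x powr r)"
  by (simp add: ennpow_def)

lemma ennpow_zero [simp]: "ennpow 0 r = 0"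
  by (simp add: ennpow_def)

lemma ennpow_top [simp]: "ennpow \<infinity> r = \<infinity>" "ennpow top r = \<infinity>"
  by (simp_all add: ennpow_def)

lemma ennpow_eq_0_iff [simp]: "ennpow x r = 0 \<longleftrightarrow> x = 0"
  by (cases x) (auto simp: ennpow_def)

lemma ennpow_eq_top_iff [simp]: "ennpow x r = top \<longleftrightarrow> x = top"
  by (cases x) (auto simp: ennpow_def)

lemma conjugate_exponent_gt_1:
  fixes r r' :: real
  assumes "1 < r" "1 / r + 1 / r' = 1"
  shows "1 < r'"
proof -
  have "0 < 1 / r" "1 / r < 1" using assms(1) by auto
  then have "0 < 1 / r'" "1 / r' < 1" using assms(2) by linarith+
  then show ?thesis by (auto simp: divide_less_eq_1 zero_less_divide_1_iff)
qed

lemma borel_measurable_ennpow [measurable (raw)]: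
  assumes [measurable]: "h \<in> borel_measurable M"
  shows "(\<lambda>x. ennpow (h x) r) \<in> borel_measurable M"
  unfolding ennpow_def by measurable

text \<open>Young's inequality for the two integrands of the weighted Hoelder inequality, divided by
  their integrals D and N. The powers of x cancel once the roots are taken. Integration then turns
  the bracket into 1 / r + 1 / r' = 1.\<close>

lemma weighted_young:
  fixes r r' w x t h D N :: real
  assumes r: "1 < r" "1 / r + 1 / r' = 1" and x: "0 < x" and nn: "0 \<le> t" "0 \<le> h" and D: "0 < D" and N: "0 < N"
  shows "t * h \<le> D powr (1 / r) * N powr (1 / r')
    * (1 / r * (x powr w * t powr r / D) + 1 / r' * (x powr (- (r' / r) * w) * h powr r' / N))"
proof (cases "t = 0 \<or> h = 0")
  case True
  have "0 < r'" using conjugate_exponent_gt_1[OF r] by simp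
  then show ?thesis using True r D N by auto
next
  case False
  then have th: "0 < t" "0 < h" using nn by auto
  have r'0: "0 < r'" using conjugate_exponent_gt_1[OF r] by simp
  let ?A = "x powr w * t powr r / D" and ?B = "x powr (- (r' / r) * w) * h powr r' / N"
  have "?A powr (1 / r) * ?B powr (1 / r') =
    (x powr (w / r) * x powr (- (r' / r) * w / r')) * (t powr (r / r) * h powr (r' / r')) / (D powr (1 / r) * N powr (1 / r'))"
    using th x D N by (simp add: powr_mult powr_divide powr_powr)
  also have "x powr (w / r) * x powr (- (r' / r) * w / r') = 1"
    using x r'0 r by (simp flip: powr_add)
  also have "t powr (r / r) * h powr (r' / r') = t * h"
    using r r'0 th by simp
  finally have "t * h = D powr (1 / r) * N powr (1 / r') * (?A powr (1 / r) * ?B powr (1 / r'))"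
    using D N by simp
  also have "?A powr (1 / r) * ?B powr (1 / r') \<le> 1 / r * ?A + 1 / r' * ?B"
    using r r'0 th x D N by (intro Youngs_inequality_0) auto
  finally show ?thesis using D N by simp
qed

lemma nn_integral_hoelder_weighted:
  fixes r r' w :: real and T :: "real \<Rightarrow> ennreal" and h :: "real \<Rightarrow> real"
  assumes r: "1 < r" "1 / r + 1 / r' = 1"
    and [measurable]: "T \<in> borel_measurable half_line" "h \<in> borel_measurable half_line"
    and h: "\<And>y. 0 \<le> h y"
  shows "(\<integral>\<^sup>+ y. T y * ennreal (h y) \<partial>half_line)
    \<le> ennpow (\<integral>\<^sup>+ y. ennreal (y powr w) * ennpow (T y) r \<partial>half_line) (1 / r)
       * ennpow (\<integral>\<^sup>+ y. ennreal (y powr (- (r' / r) * w) * h y powr r') \<partial>half_line) (1 / r')"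
proof -
  let ?D = "\<integral>\<^sup>+ y. ennreal (y powr w) * ennpow (T y) r \<partial>half_line"
  let ?N = "\<integral>\<^sup>+ y. ennreal (y powr (- (r' / r) * w) * h y powr r') \<partial>half_line"
  have [measurable]: "(\<lambda>x. x) \<in> borel_measurable half_line"
    by (auto intro: measurable_half_line)
  have r': "0 < r'" using conjugate_exponent_gt_1[OF r] by simp
  consider "?D = 0" | "?N = 0" | "?D \<noteq> 0" "?N \<noteq> 0" "?D = top \<or> ?N = top"
    | D N where "?D = ennreal D" "?N = ennreal N" "0 < D" "0 < N"
    by (cases ?D; cases ?N) (auto simp: order_less_le)
  then show ?thesis
  proof cases
    case 1
    then have "AE y in half_line. ennreal (y powr w) * ennpow (T y) r = 0"
      by (subst (asm) nn_integral_0_iff_AE) auto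
    then have "AE y in half_line. T y * ennreal (h y) = 0"
      using AE_space by eventually_elim (auto simp: space_restrict_space)
    then have "(\<integral>\<^sup>+ y. T y * ennreal (h y) \<partial>half_line) = 0"
      by (subst nn_integral_0_iff_AE) auto
    then show ?thesis by simp
  next
    case 2
    then have "AE y in half_line. ennreal (y powr (- (r' / r) * w) * h y powr r') = 0"
      by (subst (asm) nn_integral_0_iff_AE) auto
    then have "AE y in half_line. T y * ennreal (h y) = 0"
      using AE_space by eventually_elim (auto simp: space_restrict_space)
    then have "(\<integral>\<^sup>+ y. T y * ennreal (h y) \<partial>half_line) = 0"
      by (subst nn_integral_0_iff_AE) auto
    then show ?thesis by simp
  next
    case 3
    then show ?thesis by (auto simp: ennreal_mult_top ennreal_top_mult)
  next
    case (4 D N)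
    let ?C = "D powr (1 / r) * N powr (1 / r')"
    \<comment> \<open>A finite weighted integral makes T finite almost everywhere, so the inequality
      for real numbers applies.\<close>
    have "AE y in half_line. ennreal (y powr w) * ennpow (T y) r \<noteq> \<infinity>"
      using 4 by (intro nn_integral_PInf_AE) auto
    then have "AE y in half_line. T y * ennreal (h y) \<le> ennreal ?C * (ennreal (1 / r / D) * (ennreal (y powr w) * ennpow (T y) r)
       + ennreal (1 / r' / N) * ennreal (y powr (- (r' / r) * w) * h y powr r'))"
      using AE_space
    proof eventually_elim
      case (elim y)
      then have y: "0 < y" by (simp add: space_restrict_space)
      have "T y \<noteq> \<infinity>" using elim y by (auto simp: ennreal_mult_top)
      then obtain t where t: "T y = ennreal t" "0 \<le> t" by (cases "T y") auto
      have "T y * ennreal (h y) = ennreal (t * h y)"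
        using t h by (simp add: ennreal_mult)
      also have "\<dots> \<le> ennreal (?C * (1 / r * (y powr w * t powr r / D) + 1 / r' * (y powr (- (r' / r) * w) * h y powr r' / N)))"
        by (intro ennreal_leI weighted_young) (use r y t h 4 in auto)
      also have "\<dots> = ennreal ?C * (ennreal (1 / r / D) * (ennreal (y powr w) * ennpow (T y) r)
       + ennreal (1 / r' / N) * ennreal (y powr (- (r' / r) * w) * h y powr r'))"
        using r r' 4 t by (simp add: ennpow_ennreal field_simps flip: ennreal_mult ennreal_plus)
      finally show ?case .
    qed
    then have "(\<integral>\<^sup>+ y. T y * ennreal (h y) \<partial>half_line) \<le> (\<integral>\<^sup>+ y. ennreal ?C * (ennreal (1 / r / D) * (ennreal (y powr w) * ennpow (T y) r)
       + ennreal (1 / r' / N) * ennreal (y powr (- (r' / r) * w) * h y powr r')) \<partial>half_line)"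
      by (rule nn_integral_mono_AE)
    also have "\<dots> = ennreal ?C * (ennreal (1 / r / D) * ?D + ennreal (1 / r' / N) * ?N)"
      by (simp add: nn_integral_cmult nn_integral_add)
    also have "ennreal (1 / r / D) * ?D + ennreal (1 / r' / N) * ?N = 1"
      unfolding 4(1,2) using 4 r r' by (simp flip: ennreal_mult ennreal_plus)
    finally show ?thesis
      unfolding 4(1,2) using 4 by (simp add: ennpow_ennreal ennreal_mult)
  qed
qed

text \<open>Divide by D^(1/r') and raise to the power r. Finiteness of D is essential: D =
  \<infinity> satisfies the second inequality for every nonzero B. This is why the extremal function
  of the duality has to be truncated.\<close>

lemma ennpow_le_of_le_mult:
  fixes r r' :: real
  assumes r: "1 < r" "1 / r + 1 / r' = 1" and D: "D < \<infinity>" "D \<le> B * ennpow D (1 / r')"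
  shows "D \<le> ennpow B r"
proof (cases "B = \<infinity> \<or> D = 0")
  case False
  then obtain b where b: "B = ennreal b" "0 \<le> b" by (cases B) auto
  obtain d where d: "D = ennreal d" "0 < d" using False D by (cases D) (auto simp: order_less_le)
  have "d \<le> b * d powr (1 / r')"
    using D(2) b d by (simp add: ennpow_ennreal flip: ennreal_mult)
  also have "1 / r' = 1 - 1 / r" using r by simp
  finally have "d powr (1 / r) \<le> b"
    using d by (simp add: powr_diff field_simps)
  then have "(d powr (1 / r)) powr r \<le> b powr r"
    using r by (intro powr_mono2) auto
  then show ?thesis
    using b d r by (simp add: ennpow_ennreal powr_powr)
qed auto

text \<open>The extremal function of the duality is truncated in value and in domain, since neither \<open>T\<close> nor
  its norm is known to be finite.\<close>

lemma norm_le_of_dual_le: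
  fixes r r' w :: real and T :: "real \<Rightarrow> ennreal"
  assumes r: "1 < r" "1 / r + 1 / r' = 1"
    and T [measurable]: "T \<in> borel_measurable half_line"
    and dual: "\<And>h. h \<in> borel_measurable half_line \<Longrightarrow> (\<And>y. 0 \<le> h y) \<Longrightarrow>
      (\<integral>\<^sup>+ y. T y * ennreal (h y) \<partial>half_line)
        \<le> B * ennpow (\<integral>\<^sup>+ y. ennreal (y powr (- (r' / r) * w) * h y powr r') \<partial>half_line) (1 / r')"
  shows "ennpow (\<integral>\<^sup>+ y. ennreal (y powr w) * ennpow (T y) r \<partial>half_line) (1 / r) \<le> B"
proof -
  have [measurable]: "(\<lambda>x. x) \<in> borel_measurable half_line"
    by (auto intro: measurable_half_line)
  have r': "0 < r'" using conjugate_exponent_gt_1[OF r] by simp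
  have rr: "r' * (r - 1) = r" using r r' by (simp add: field_simps)
  have rw: "- (r' / r) * w + w * r' = w" using r r' by (simp add: field_simps) algebra
  \<comment> \<open>Without truncation h would be y^w T^(r - 1). By \<open>rr\<close> and
    \<open>rw\<close> both T h and y^(-(r'/r) w) h^r' then equal y^w T^r, so h turns the dual bound
    into an inequality for one quantity. \<open>u n\<close> is the truncated version of this common
    value.\<close>
  define \<tau> where "\<tau> n y = enn2real (min (T y) (of_nat n))" for n :: nat and y
  \<comment> \<open>For n = 0 division by zero gives \<open>S 0 = {0}\<close>, which misses the
    half-line.\<close>
  define S where "S n = {1 / real n..real n}" for n
  define h where "h n y = indicator (S n) y * (y powr w * \<tau> n y powr (r - 1))" for n y
  define u where "u n y = ennreal (indicator (S n) y * (y powr w * \<tau> n y powr r))" for n y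
  have min_fin: "min (T y) (of_nat n) < \<infinity>" for n y
    by (simp add: min_less_iff_disj of_nat_less_top)
  have \<tau>: "ennreal (\<tau> n y) = min (T y) (of_nat n)" "0 \<le> \<tau> n y" "\<tau> n y \<le> n" for n y
  proof -
    show "ennreal (\<tau> n y) = min (T y) (of_nat n)" using min_fin[of y n] by (simp add: \<tau>_def)
    show "0 \<le> \<tau> n y" by (simp add: \<tau>_def)
    have "ennreal (\<tau> n y) \<le> ennreal n"
      using \<open>ennreal (\<tau> n y) = _\<close> by (simp add: ennreal_of_nat_eq_real_of_nat)
    then show "\<tau> n y \<le> n" by simp
  qed
  have [measurable]: "\<tau> n \<in> borel_measurable half_line" for n
    unfolding \<tau>_def[abs_def] by measurable
  have [measurable]: "(\<lambda>y. indicator (S n) y :: real) \<in> borel_measurable half_line" for n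
    by (intro measurable_half_line) (auto simp: S_def)
  have [measurable]: "h n \<in> borel_measurable half_line" "u n \<in> borel_measurable half_line" for n
    unfolding h_def[abs_def] u_def[abs_def] by measurable
  have le: "(\<integral>\<^sup>+ y. u n y \<partial>half_line) \<le> ennpow B r" for n
  proof (rule ennpow_le_of_le_mult[OF r])
    have "(\<integral>\<^sup>+ y. u n y \<partial>half_line) \<le> (\<integral>\<^sup>+ y. ennreal (n powr \<bar>w\<bar> * n powr r) * indicator (S n) y \<partial>lborel)"
      unfolding nn_integral_half_line
    proof (rule nn_integral_mono)
      fix y :: real
      show "u n y * indicator {0<..} y \<le> ennreal (n powr \<bar>w\<bar> * n powr r) * indicator (S n) y"
      proof (cases "0 < y \<and> y \<in> S n")
        case True
        then have y: "1 / real n \<le> y" "y \<le> real n" "0 < y" by (auto simp: S_def)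
        then have n: "0 < real n" by linarith
        \<comment> \<open>On \<open>S n\<close> the logarithm is bounded by ln n in absolute value,
          which bounds y^w for either sign of w.\<close>
        have "\<bar>ln y\<bar> \<le> ln n"
        proof -
          have "ln (1 / real n) \<le> ln y" "ln y \<le> ln (real n)" using y n by (auto simp: ln_le_cancel_iff simp del: ln_div)
          then show ?thesis using n by (simp add: ln_div)
        qed
        then have "w * ln y \<le> \<bar>w\<bar> * ln n"
          by (metis abs_ge_self abs_ge_zero abs_mult mult_left_mono order_trans)
        then have "y powr w \<le> n powr \<bar>w\<bar>" using y n by (simp add: powr_def)
        moreover have "\<tau> n y powr r \<le> n powr r" using \<tau>[of n y] r by (intro powr_mono2) auto
        ultimately have "y powr w * \<tau> n y powr r \<le> n powr \<bar>w\<bar> * n powr r"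
          by (intro mult_mono) auto
        then show ?thesis using True by (simp add: u_def)
      qed (auto simp: u_def)
    qed
    also have "\<dots> < \<infinity>"
      by (subst nn_integral_cmult_indicator) (auto simp: S_def ennreal_mult_less_top emeasure_lborel_Icc_eq)
    finally show "(\<integral>\<^sup>+ y. u n y \<partial>half_line) < \<infinity>" .
    have "(\<integral>\<^sup>+ y. u n y \<partial>half_line) \<le> (\<integral>\<^sup>+ y. T y * ennreal (h n y) \<partial>half_line)"
    proof (rule nn_integral_mono)
      fix y
      have "\<tau> n y powr r = \<tau> n y * \<tau> n y powr (r - 1)"
        using \<tau>(2)[of n y] by (cases "\<tau> n y = 0") (auto simp: powr_diff)
      then have "u n y = ennreal (\<tau> n y) * ennreal (h n y)"
        using \<tau>(2)[of n y] by (simp add: u_def h_def mult_ac flip: ennreal_mult)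
      also have "\<dots> \<le> T y * ennreal (h n y)"
        by (intro mult_right_mono) (auto simp: \<tau>)
      finally show "u n y \<le> T y * ennreal (h n y)" .
    qed
    also have "\<dots> \<le> B * ennpow (\<integral>\<^sup>+ y. ennreal (y powr (- (r' / r) * w) * h n y powr r') \<partial>half_line) (1 / r')"
      by (rule dual) (auto simp: h_def)
    also have "(\<integral>\<^sup>+ y. ennreal (y powr (- (r' / r) * w) * h n y powr r') \<partial>half_line) = (\<integral>\<^sup>+ y. u n y \<partial>half_line)"
    proof (rule nn_integral_cong)
      fix y assume "y \<in> space half_line"
      then have y: "0 < y" by (simp add: space_restrict_space)
      have "y powr (- (r' / r) * w) * (y powr w * \<tau> n y powr (r - 1)) powr r'
          = y powr (- (r' / r) * w + w * r') * \<tau> n y powr (r' * (r - 1))"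
        by (simp only: powr_mult powr_powr powr_add mult_ac)
      then show "ennreal (y powr (- (r' / r) * w) * h n y powr r') = u n y"
        unfolding rr rw by (cases "y \<in> S n") (use r' in \<open>auto simp: h_def u_def\<close>)
    qed
    finally show "(\<integral>\<^sup>+ y. u n y \<partial>half_line) \<le> B * ennpow (\<integral>\<^sup>+ y. u n y \<partial>half_line) (1 / r')" .
  qed
  have lim: "(\<lambda>n. u n y) \<longlonglongrightarrow> ennreal (y powr w) * ennpow (T y) r" if y: "0 < y" for y
  proof -
    have S: "eventually (\<lambda>n. y \<in> S n) sequentially"
    proof -
      obtain N :: nat where N: "max y (1 / y) \<le> N" using real_arch_simple by blast
      then have "y \<in> S n" if "N \<le> n" for n
      proof -
        have "max y (1 / y) \<le> n" using N that by (meson of_nat_le_iff order_trans)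
        then have 1: "y \<le> n" "1 / y \<le> n" by auto
        then have "1 / n \<le> y" using y by (simp add: field_simps)
        then show ?thesis using 1 by (simp add: S_def)
      qed
      then show ?thesis by (auto simp: eventually_sequentially)
    qed
    show ?thesis
    proof (cases "T y")
      case (real t)
      obtain N :: nat where N: "t \<le> N" using real_arch_simple by blast
      have "eventually (\<lambda>n. u n y = ennreal (y powr w) * ennpow (T y) r) sequentially"
        using S eventually_ge_at_top[of N]
      proof eventually_elim
        case (elim n)
        then have "t \<le> n" using N by (meson of_nat_le_iff order_trans)
        then have "\<tau> n y = t"
          using real by (simp add: \<tau>_def ennreal_of_nat_eq_real_of_nat min_def)
        then show ?case using elim real by (simp add: u_def ennpow_ennreal ennreal_mult)
      qed
      then show ?thesis by (rule tendsto_eventually)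
    next
      \<comment> \<open>Here the truncation equals n, so \<open>u n y\<close> is eventually y^w n^r
        and tends to \<infinity>.\<close>
      case top
      have "eventually (\<lambda>n. ennreal (y powr w * real n powr r) = u n y) sequentially"
        using S
      proof eventually_elim
        case (elim n)
        have "\<tau> n y = n" using top by (simp add: \<tau>_def)
        then show ?case using elim by (simp add: u_def)
      qed
      moreover have "filterlim (\<lambda>n. y powr w * real n powr r) at_top sequentially"
        using y r by real_asymp
      then have "(\<lambda>n. ennreal (y powr w * real n powr r)) \<longlonglongrightarrow> \<infinity>"
        by (simp add: ennreal_tendsto_top_eq_at_top)
      ultimately have "(\<lambda>n. u n y) \<longlonglongrightarrow> \<infinity>" by (rule Lim_transform_eventually[rotated])
      then show ?thesis using top y by (simp add: ennreal_mult_top)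
    qed
  qed
  \<comment> \<open>Fatou's lemma removes the truncation, using only the pointwise limit of
    \<open>u n\<close> and the uniform bound \<open>le\<close>.\<close>
  have "(\<integral>\<^sup>+ y. ennreal (y powr w) * ennpow (T y) r \<partial>half_line) = (\<integral>\<^sup>+ y. liminf (\<lambda>n. u n y) \<partial>half_line)"
    by (intro nn_integral_cong) (use lim in \<open>auto simp: space_restrict_space intro!: lim_imp_Liminf[symmetric]\<close>)
  also have "\<dots> \<le> liminf (\<lambda>n. \<integral>\<^sup>+ y. u n y \<partial>half_line)"
    by (rule nn_integral_liminf) auto
  also have "\<dots> \<le> ennpow B r"
    by (rule Liminf_le) (simp_all add: le)
  finally have *: "(\<integral>\<^sup>+ y. ennreal (y powr w) * ennpow (T y) r \<partial>half_line) \<le> ennpow B r" .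
  show ?thesis
  proof (cases B)
    case (real b)
    obtain d where d: "(\<integral>\<^sup>+ y. ennreal (y powr w) * ennpow (T y) r \<partial>half_line) = ennreal d" "0 \<le> d"
      using * real by (cases "(\<integral>\<^sup>+ y. ennreal (y powr w) * ennpow (T y) r \<partial>half_line)") (auto simp: ennpow_ennreal top_unique)
    have "d \<le> b powr r" using * d real by (simp add: ennpow_ennreal)
    then have "d powr (1 / r) \<le> (b powr r) powr (1 / r)" using d r by (intro powr_mono2) auto
    then show ?thesis using d real r by (simp add: ennpow_ennreal powr_powr)
  qed simp
qed

section \<open>Factorization of the kernel\<close>

lemma ennreal_divide_mult:
  "0 < m \<Longrightarrow> 0 \<le> c \<Longrightarrow> 0 \<le> d \<Longrightarrow> ennreal (c / m * d) = ennreal (1 / m) * (ennreal c * ennreal d)"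
  by (simp flip: ennreal_mult)

locale hilbert_setting =
  fixes p q p' q' l pt qt \<alpha>1 \<alpha>2 s1 s2 A1 A2 :: real
  assumes p: "1 < p" and q: "1 < q" and pq: "1 / p + 1 / q \<ge> 1"
    and p': "1 / p + 1 / p' = 1" and q': "1 / q + 1 / q' = 1"
    and pt: "0 \<le> pt" and qt: "0 \<le> qt"
    and \<alpha>: "0 < \<alpha>1" "0 < \<alpha>2"
    and A1: "(1 - s1 - s2) / p' < A1" "A1 < 1 / p'"
    and A2: "(1 - s1 - s2) / q' < A2" "A2 < 1 / q'"
    and l: "l = 1 / p' + 1 / q'"
begin

text \<open>\<open>mF\<close> and \<open>mG\<close> are the masses of the two densities, so that \<open>a\<close> and \<open>b\<close> are probability densities in
  \<open>y\<close> and in \<open>x\<close> respectively.\<close>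

definition "z = (\<alpha>1 - \<alpha>2) / \<alpha>1"
definition "mF = Beta (1 - q' * A2) (s1 + s2 + q' * A2 - 1)
  * ext_hypergeom s2 (1 - q' * A2) (s1 + s2) z (q' * pt) (q' * qt)"
definition "mG = Beta (1 - p' * A1) (s1 + s2 + p' * A1 - 1)
  * ext_hypergeom s1 (1 - p' * A1) (s1 + s2) z (p' * pt) (p' * qt)"
definition "a x y = \<alpha>1 / x / mF
  * gauss_density s2 (1 - q' * A2) (s1 + s2) z (q' * pt) (q' * qt) (\<alpha>1 / x * y)"
definition "b x y = 1 / (\<alpha>2 * y) / mG
  * gauss_density s1 (1 - p' * A1) (s1 + s2) z (p' * pt) (p' * qt) (1 / (\<alpha>2 * y) * x)"
definition "wF = p / q' * (1 - s1 - s2) + p * (A1 - A2)"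
definition "wG = q / p' * (1 - s1 - s2) + q * (A2 - A1)"
definition "W f x = x powr wF * f x powr p" for f :: "real \<Rightarrow> real"
definition "V g y = y powr wG * g y powr q" for g :: "real \<Rightarrow> real"
definition "k = exp_kernel l s1 s2 \<alpha>1 \<alpha>2 pt qt"
definition "C = exp (2 * (pt + qt)) * (const_F q' s1 s2 \<alpha>1 \<alpha>2 A2 (q' * pt) (q' * qt)
             * const_G p' s1 s2 \<alpha>1 \<alpha>2 A1 (p' * pt) (p' * qt))"

lemma p'_gt_1: "1 < p'" and q'_gt_1: "1 < q'"
  using conjugate_exponent_gt_1 p p' q q' by auto

lemma z: "z < 1" "1 - z = \<alpha>2 / \<alpha>1"
  using \<alpha> by (auto simp: z_def field_simps)

text \<open>Multiplied by \<open>q'\<close> and \<open>p'\<close>, the admissible intervals for A2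
  and A1 become the conditions 0 < b < c under which the two Euler integrals converge.\<close>

lemma A2_bounds: "0 < 1 - q' * A2" "1 - q' * A2 < s1 + s2"
  and A1_bounds: "0 < 1 - p' * A1" "1 - p' * A1 < s1 + s2"
  using A1 A2 p'_gt_1 q'_gt_1 by (auto simp: field_simps)

lemma l_bounds: "0 < l" "l \<le> 1"
proof -
  have "0 < 1 / p'" "0 < 1 / q'" using p'_gt_1 q'_gt_1 by auto
  then show "0 < l" "l \<le> 1" using l pq p' q' by linarith+
qed

lemma
  shows mF_pos: "0 < mF" and mG_pos: "0 < mG"
    and beta_F_pos: "0 < Beta (1 - q' * A2) (s1 + s2 + q' * A2 - 1)"
    and beta_G_pos: "0 < Beta (1 - p' * A1) (s1 + s2 + p' * A1 - 1)"
    and hyper_F_pos: "0 < ext_hypergeom s2 (1 - q' * A2) (s1 + s2) z (q' * pt) (q' * qt)"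
    and hyper_G_pos: "0 < ext_hypergeom s1 (1 - p' * A1) (s1 + s2) z (p' * pt) (p' * qt)"
proof -
  show 1: "0 < Beta (1 - q' * A2) (s1 + s2 + q' * A2 - 1)" "0 < Beta (1 - p' * A1) (s1 + s2 + p' * A1 - 1)"
    using A1_bounds A2_bounds by (auto intro!: Beta_real_pos)
  show 2: "0 < ext_hypergeom s2 (1 - q' * A2) (s1 + s2) z (q' * pt) (q' * qt)"
     "0 < ext_hypergeom s1 (1 - p' * A1) (s1 + s2) z (p' * pt) (p' * qt)"
    using A1_bounds A2_bounds z pt qt p'_gt_1 q'_gt_1 by (auto intro!: ext_hypergeom_pos)
  show "0 < mF" "0 < mG" unfolding mF_def mG_def using 1 2 by simp_all
qed

lemma C_pos: "0 < C"
  using beta_F_pos beta_G_pos hyper_F_pos hyper_G_pos \<alpha>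
  unfolding C_def const_F_def const_G_def z_def by simp

lemma a_pos: "0 < x \<Longrightarrow> 0 < y \<Longrightarrow> 0 < a x y"
  and b_pos: "0 < x \<Longrightarrow> 0 < y \<Longrightarrow> 0 < b x y"
  unfolding a_def b_def using \<alpha> z mF_pos mG_pos
  by (auto intro!: mult_pos_pos divide_pos_pos gauss_density_pos)

lemma a_homogeneous: "a (2 * x) (2 * y) = a x y / 2"
  and b_homogeneous: "b (2 * x) (2 * y) = b x y / 2"
  by (simp_all add: a_def b_def)

lemma measurable_a: "case_prod a \<in> borel_measurable (borel \<Otimes>\<^sub>M borel)"
  and measurable_b: "case_prod b \<in> borel_measurable (borel \<Otimes>\<^sub>M borel)"
  unfolding a_def[abs_def] b_def[abs_def] by measurable

lemma measurable_k [measurable]: "case_prod k \<in> borel_measurable (borel \<Otimes>\<^sub>M borel)"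
  unfolding k_def exp_kernel_def[abs_def] by measurable

text \<open>The dilation u = \<alpha>1 y / x turns the total mass into
  \<open>mF / mF\<close>.\<close>

lemma nn_integral_a:
  assumes x: "0 < x" shows "(\<integral>\<^sup>+ y. ennreal (a x y) \<partial>half_line) = 1"
proof -
  let ?d = "gauss_density s2 (1 - q' * A2) (s1 + s2) z (q' * pt) (q' * qt)"
  have c: "0 < \<alpha>1 / x" using x \<alpha> by simp
  have "ennreal mF = (\<integral>\<^sup>+ u. ennreal (?d u) \<partial>half_line)"
    using A2_bounds z pt qt q'_gt_1 by (subst nn_integral_gauss_density) (auto simp: mF_def algebra_simps)
  also have "\<dots> = ennreal (\<alpha>1 / x) * (\<integral>\<^sup>+ u. ennreal (?d (\<alpha>1 / x * u)) \<partial>half_line)"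
    using c by (intro nn_integral_half_line_scale) auto
  finally have 1: "ennreal (1 / mF) * (ennreal (\<alpha>1 / x) * (\<integral>\<^sup>+ u. ennreal (?d (\<alpha>1 / x * u)) \<partial>half_line)) = 1"
    using mF_pos by (metis divide_self ennreal_1 ennreal_mult less_imp_le less_numeral_extra(3) times_divide_eq_left mult_1 zero_le_divide_1_iff)
  have "(\<integral>\<^sup>+ y. ennreal (a x y) \<partial>half_line) = (\<integral>\<^sup>+ y. ennreal (1 / mF) * (ennreal (\<alpha>1 / x) * ennreal (?d (\<alpha>1 / x * y))) \<partial>half_line)"
  proof (intro nn_integral_cong)
    fix y
    show "ennreal (a x y) = ennreal (1 / mF) * (ennreal (\<alpha>1 / x) * ennreal (?d (\<alpha>1 / x * y)))"
      unfolding a_def using c mF_pos by (intro ennreal_divide_mult gauss_density_nonneg) auto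
  qed
  also have "\<dots> = 1"
    unfolding 1[symmetric]
    by (subst nn_integral_cmult, (rule measurable_half_line, measurable)[1],
        subst nn_integral_cmult, (rule measurable_half_line, measurable)[1]) simp
  finally show ?thesis .
qed

lemma nn_integral_b:
  assumes y: "0 < y" shows "(\<integral>\<^sup>+ x. ennreal (b x y) \<partial>half_line) = 1"
proof -
  let ?d = "gauss_density s1 (1 - p' * A1) (s1 + s2) z (p' * pt) (p' * qt)"
  let ?c = "1 / (\<alpha>2 * y)"
  have c: "0 < ?c" using y \<alpha> by simp
  have "ennreal mG = (\<integral>\<^sup>+ u. ennreal (?d u) \<partial>half_line)"
    using A1_bounds z pt qt p'_gt_1 by (subst nn_integral_gauss_density) (auto simp: mG_def algebra_simps)
  also have "\<dots> = ennreal ?c * (\<integral>\<^sup>+ u. ennreal (?d (?c * u)) \<partial>half_line)"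
    using c by (intro nn_integral_half_line_scale) auto
  finally have 1: "ennreal (1 / mG) * (ennreal ?c * (\<integral>\<^sup>+ u. ennreal (?d (?c * u)) \<partial>half_line)) = 1"
    using mG_pos by (metis divide_self ennreal_1 ennreal_mult less_imp_le less_numeral_extra(3) times_divide_eq_left mult_1 zero_le_divide_1_iff)
  have "(\<integral>\<^sup>+ x. ennreal (b x y) \<partial>half_line) = (\<integral>\<^sup>+ x. ennreal (1 / mG) * (ennreal ?c * ennreal (?d (?c * x))) \<partial>half_line)"
  proof (intro nn_integral_cong)
    fix x
    show "ennreal (b x y) = ennreal (1 / mG) * (ennreal ?c * ennreal (?d (?c * x)))"
      unfolding b_def using c mG_pos by (intro ennreal_divide_mult gauss_density_nonneg) auto
  qed
  also have "\<dots> = 1"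
    unfolding 1[symmetric]
    by (subst nn_integral_cmult, (rule measurable_half_line, measurable)[1],
        subst nn_integral_cmult, (rule measurable_half_line, measurable)[1]) simp
  finally show ?thesis .
qed

text \<open>The factor \<open>exp (2 * (pt + qt))\<close> in \<open>C\<close> compensates the terms \<open>1\<close> in \<open>1 + 1 / u\<close> and \<open>1 + u\<close> of the two
  Gauss densities.\<close>

lemma kernel_factorization:
  assumes x: "0 < x" and y: "0 < y" and fg: "0 \<le> f x" "0 \<le> g y"
  shows "k x y * f x * g y = C *
    ((a x y * W f x) powr (1 / q') * (b x y * V g y) powr (1 / p') * (W f x * V g y) powr (1 - l))"
proof (cases "f x = 0 \<or> g y = 0")
  \<comment> \<open>\<open>0 powr r\<close> is 0 also for r = 0, so both sides vanish even when l =
    1.\<close>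
  case True
  then show ?thesis using p q p'_gt_1 q'_gt_1 by (auto simp: W_def V_def)
next
  case False
  then have f: "0 < f x" and g: "0 < g y" using fg by auto
  have c: "0 < x + \<alpha>1 * y" "0 < x + \<alpha>2 * y" using x y \<alpha> by (auto intro: add_pos_pos)
  have WV: "0 < W f x" "0 < V g y" using x y f g by (auto simp: W_def V_def)
  have k: "0 < k x y" using c by (simp add: k_def exp_kernel_def)
  let ?X = "ln x" and ?Y = "ln y" and ?U = "ln (x + \<alpha>1 * y)" and ?V = "ln (x + \<alpha>2 * y)"
  let ?s = "x / y / \<alpha>1" and ?t = "x / y / \<alpha>2" and ?v = "\<alpha>1 * (y / x)" and ?w = "\<alpha>2 * (y / x)"
  \<comment> \<open>The exponent of the kernel splits into four terms: \<open>?s\<close> and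
    \<open>?v\<close> come from the density \<open>a\<close>, \<open>?w\<close> and
    \<open>?t\<close> from \<open>b\<close>.\<close>
  have lnk: "ln (k x y) = - qt * ?v - pt * ?w - pt * ?s - qt * ?t - l * s1 * ?U - l * s2 * ?V"
  proof -
    have "- (\<alpha>1 * qt + \<alpha>2 * pt) * (y / x + 1 / (\<alpha>1 * \<alpha>2) * (x / y)) = - qt * ?v - pt * ?w - pt * ?s - qt * ?t"
      using \<alpha> x y by (simp add: field_simps)
    then show ?thesis
      unfolding k_def exp_kernel_def using c by (simp add: ln_div ln_mult ln_powr)
  qed
  have lna: "ln (a x y) = ln \<alpha>1 - ?X - ln mF - q' * A2 * (ln \<alpha>1 + ?Y - ?X)
    - s1 * (?U - ?X) - s2 * (?V - ?X) - q' * pt * (1 + ?s) - q' * qt * (1 + ?v)"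
  proof -
    \<comment> \<open>At u = \<alpha>1 y / x the factors 1 + u and 1 + (1 - z) u produce x +
      \<alpha>1 y and x + \<alpha>2 y, in this order.\<close>
    have 1: "1 + \<alpha>1 / x * y = (x + \<alpha>1 * y) / x" "1 + (1 - z) * (\<alpha>1 / x * y) = (x + \<alpha>2 * y) / x"
      "1 / (\<alpha>1 / x * y) = ?s" "\<alpha>1 / x * y = ?v"
      using x y \<alpha> by (auto simp: z(2) field_simps)
    have u: "0 < \<alpha>1 / x * y" using x y \<alpha> by simp
    have lns: "ln ((x + \<alpha>1 * y) / x) = ?U - ?X" "ln ((x + \<alpha>2 * y) / x) = ?V - ?X" "ln ?v = ln \<alpha>1 + ?Y - ?X"
      using c x y \<alpha> by (simp_all add: ln_div ln_mult)
    have e: "ln (1 + \<alpha>1 / x * y) = ?U - ?X" "ln (1 + (1 - z) * (\<alpha>1 / x * y)) = ?V - ?X"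
      by (simp_all only: 1(1,2) lns)
    have e': "ln (\<alpha>1 / x * y) = ln \<alpha>1 + ?Y - ?X"
      by (simp only: 1(4) lns)
    have lnd: "ln (gauss_density s2 (1 - q' * A2) (s1 + s2) z (q' * pt) (q' * qt) (\<alpha>1 / x * y))
      = - q' * A2 * (ln \<alpha>1 + ?Y - ?X) - s1 * (?U - ?X) - s2 * (?V - ?X) - q' * pt * (1 + ?s) - q' * qt * (1 + ?v)"
      unfolding ln_gauss_density[OF u z(1)] e e' 1(3) unfolding 1(4) by simp
    have split: "ln (\<alpha>1 / x / mF * d) = ln \<alpha>1 - ?X - ln mF + ln d" if "0 < d" for d
      using that x \<alpha> mF_pos by (simp add: ln_mult ln_div)
    show ?thesis
      unfolding a_def split[OF gauss_density_pos[OF u z(1)]] lnd by simp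
  qed
  have lnb: "ln (b x y) = - ln \<alpha>2 - ?Y - ln mG - p' * A1 * (?X - ln \<alpha>2 - ?Y)
    - s2 * (?V - ln \<alpha>2 - ?Y) - s1 * (?U - ln \<alpha>1 - ?Y) - p' * pt * (1 + ?w) - p' * qt * (1 + ?t)"
  proof -
    \<comment> \<open>At u = x / (\<alpha>2 y) the two linear forms appear in the opposite order.
      This is why s1 and s2 change places between the parameters of the two hypergeometric
      functions.\<close>
    have 1: "1 + 1 / (\<alpha>2 * y) * x = (x + \<alpha>2 * y) / (\<alpha>2 * y)"
      "1 + (1 - z) * (1 / (\<alpha>2 * y) * x) = (x + \<alpha>1 * y) / (\<alpha>1 * y)"
      "1 / (1 / (\<alpha>2 * y) * x) = ?w" "1 / (\<alpha>2 * y) * x = ?t"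
      using x y \<alpha> by (auto simp: z(2) field_simps)
    have u: "0 < 1 / (\<alpha>2 * y) * x" using x y \<alpha> by simp
    have lns: "ln ((x + \<alpha>2 * y) / (\<alpha>2 * y)) = ?V - ln \<alpha>2 - ?Y" "ln ((x + \<alpha>1 * y) / (\<alpha>1 * y)) = ?U - ln \<alpha>1 - ?Y"
      "ln ?t = ?X - ln \<alpha>2 - ?Y"
      using c x y \<alpha> by (simp_all add: ln_div ln_mult)
    have e: "ln (1 + 1 / (\<alpha>2 * y) * x) = ?V - ln \<alpha>2 - ?Y"
      "ln (1 + (1 - z) * (1 / (\<alpha>2 * y) * x)) = ?U - ln \<alpha>1 - ?Y"
      by (simp_all only: 1(1,2) lns)
    have e': "ln (1 / (\<alpha>2 * y) * x) = ?X - ln \<alpha>2 - ?Y"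
      by (simp only: 1(4) lns)
    have lnd: "ln (gauss_density s1 (1 - p' * A1) (s1 + s2) z (p' * pt) (p' * qt) (1 / (\<alpha>2 * y) * x))
      = - p' * A1 * (?X - ln \<alpha>2 - ?Y) - s2 * (?V - ln \<alpha>2 - ?Y) - s1 * (?U - ln \<alpha>1 - ?Y) - p' * pt * (1 + ?w) - p' * qt * (1 + ?t)"
      unfolding ln_gauss_density[OF u z(1)] e e' 1(3) unfolding 1(4) by simp
    have split: "ln (1 / (\<alpha>2 * y) / mG * d) = - ln \<alpha>2 - ?Y - ln mG + ln d" if "0 < d" for d
      using that y \<alpha> mG_pos by (simp add: ln_mult ln_div)
    show ?thesis
      unfolding b_def split[OF gauss_density_pos[OF u z(1)]] lnd by simp
  qed
  have lnC: "ln C = 2 * (pt + qt) + (A2 - 1 / q') * ln \<alpha>1 + 1 / q' * ln mF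
    - s1 * (1 / p') * ln \<alpha>1 + ((1 - s2) * (1 / p') - A1) * ln \<alpha>2 + 1 / p' * ln mG"
    unfolding C_def const_F_def const_G_def mF_def mG_def z_def[symmetric]
    using beta_F_pos beta_G_pos hyper_F_pos hyper_G_pos \<alpha>
    by (simp add: ln_mult ln_powr algebra_simps)
  have lnW: "ln (W f x) = p * ((1 / q' * (1 - s1 - s2) + A1 - A2) * ?X + ln (f x))"
    using x f by (simp add: W_def wF_def ln_mult ln_powr algebra_simps)
  have lnV: "ln (V g y) = q * ((1 / p' * (1 - s1 - s2) + A2 - A1) * ?Y + ln (g y))"
    using y g by (simp add: V_def wG_def ln_mult ln_powr algebra_simps)
  \<comment> \<open>With the reciprocals as atoms the logarithmic identity becomes polynomial; the
    relations used are q' R = 1, p' P = 1, p (1 - P) = 1, q (1 - R) = 1 and l = P + R.\<close>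
  define R where "R = 1 / q'"
  define P where "P = 1 / p'"
  have qR: "q' * R = 1" and pP: "p' * P = 1" using p'_gt_1 q'_gt_1 by (auto simp: R_def P_def)
  have lRP: "l = P + R" using l by (simp add: R_def P_def)
  have pp: "p * (1 - P) = 1" using p p' by (simp add: P_def field_simps)
  have qq: "q * (1 - R) = 1" using q q' by (simp add: R_def field_simps)
  have Ra: "R * ln (a x y) = R * (ln \<alpha>1 - ?X - ln mF - s1 * (?U - ?X) - s2 * (?V - ?X))
     - (q' * R) * (A2 * (ln \<alpha>1 + ?Y - ?X) + pt * (1 + ?s) + qt * (1 + ?v))"
    unfolding lna by (simp add: algebra_simps)
  have Pb: "P * ln (b x y) = P * (- ln \<alpha>2 - ?Y - ln mG - s2 * (?V - ln \<alpha>2 - ?Y) - s1 * (?U - ln \<alpha>1 - ?Y))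
     - (p' * P) * (A1 * (?X - ln \<alpha>2 - ?Y) + pt * (1 + ?w) + qt * (1 + ?t))"
    unfolding lnb by (simp add: algebra_simps)
  \<comment> \<open>The total exponent R + 1 - l of W equals 1 - P = 1 / p, which turns f^p back
    into f.\<close>
  have W': "R * ln (W f x) + (1 - l) * ln (W f x) = (R * (1 - s1 - s2) + A1 - A2) * ?X + ln (f x)"
  proof -
    have "R * ln (W f x) + (1 - l) * ln (W f x) = (p * (1 - P)) * ((R * (1 - s1 - s2) + A1 - A2) * ?X + ln (f x))"
      unfolding lnW lRP R_def[symmetric] by (simp add: algebra_simps)
    then show ?thesis by (simp add: pp)
  qed
  have V': "P * ln (V g y) + (1 - l) * ln (V g y) = (P * (1 - s1 - s2) + A2 - A1) * ?Y + ln (g y)"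
  proof -
    have "P * ln (V g y) + (1 - l) * ln (V g y) = (q * (1 - R)) * ((P * (1 - s1 - s2) + A2 - A1) * ?Y + ln (g y))"
      unfolding lnV lRP P_def[symmetric] by (simp add: algebra_simps)
    then show ?thesis by (simp add: qq)
  qed
  let ?rhs = "C * ((a x y * W f x) powr R * (b x y * V g y) powr P * (W f x * V g y) powr (1 - l))"
  have "ln ?rhs = ln C + R * ln (a x y) + P * ln (b x y)
      + (R * ln (W f x) + (1 - l) * ln (W f x)) + (P * ln (V g y) + (1 - l) * ln (V g y))"
    using C_pos a_pos[OF x y] b_pos[OF x y] WV by (simp add: ln_mult ln_powr algebra_simps)
  also have "\<dots> = ln (k x y) + ln (f x) + ln (g y)"
    unfolding W' V' Ra Pb qR pP lnC lnk unfolding lRP R_def[symmetric] P_def[symmetric]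
    by (simp add: algebra_simps)
  also have "\<dots> = ln (k x y * f x * g y)"
    using k f g by (simp add: ln_mult)
  finally have "ln ?rhs = ln (k x y * f x * g y)" .
  moreover have "0 < ?rhs" "0 < k x y * f x * g y"
    using C_pos a_pos[OF x y] b_pos[OF x y] WV k f g by simp_all
  ultimately show ?thesis by (simp add: R_def P_def)
qed

end

section \<open>The inequalities and their equality cases\<close>

lemma nn_integral_lebesgue_on_half_line:
  "(\<integral>\<^sup>+ x. h x \<partial>lebesgue_on {0<..}) = (\<integral>\<^sup>+ x. h x \<partial>half_line)"
  by (simp add: nn_integral_restrict_space nn_integral_completion)

lemma AE_lebesgue_on_half_line:
  "(AE x in lebesgue_on {0<..}. Q x) \<longleftrightarrow> (AE x in half_line. Q x)"
  by (simp add: AE_restrict_space_iff AE_completion_iff)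

lemma nonneg_measurable_of_half_line:
  assumes h: "h \<in> borel_measurable half_line" and nn: "\<And>x. 0 < x \<Longrightarrow> 0 \<le> h x"
  shows "nonneg_measurable h"
proof -
  have "(\<lambda>x. indicator {0<..} x *\<^sub>R h x) \<in> borel_measurable lborel"
    using h by (subst (asm) borel_measurable_restrict_space_iff) auto
  then have "h \<in> borel_measurable (lebesgue_on {0<..})"
    by (subst borel_measurable_restrict_space_iff) (auto intro: measurable_completion)
  then show ?thesis using nn by (simp add: nonneg_measurable_def)
qed

text \<open>The Hoelder inequality and the dilations are stated for Borel functions. The replacement
  is harmless because every integral in (I) and (II) sees f and g only up to null sets.\<close>

lemma nonneg_measurable_borel_representative:
  assumes "nonneg_measurable f"
  obtains f0 where "f0 \<in> borel_measurable borel" "\<And>x. 0 \<le> f0 x" "AE x in half_line. f x = f0 x"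
proof -
  have "(\<lambda>x. indicator {0<..} x *\<^sub>R f x) \<in> borel_measurable lebesgue"
    using assms unfolding nonneg_measurable_def
    by (subst (asm) borel_measurable_restrict_space_iff) auto
  then obtain f1 where f1: "f1 \<in> borel_measurable lborel"
      "AE x in lborel. indicator {0<..} x *\<^sub>R f x = f1 x"
    using completion_ex_borel_measurable_real by blast
  show ?thesis
  proof
    show "(\<lambda>x. max 0 (f1 x)) \<in> borel_measurable borel" using f1(1) by simp
    show "AE x in half_line. f x = max 0 (f1 x)"
      unfolding AE_half_line using f1(2)
      by eventually_elim (use assms in \<open>auto simp: nonneg_measurable_def\<close>)
  qed simp
qed

lemma sigma_finite_half_line: "sigma_finite_measure half_line"
  by (rule sigma_finite_measure_restrict_space) (auto intro: sigma_finite_lborel)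

lemma measurable_half_line_pair:
  assumes [measurable]: "h \<in> borel_measurable (borel \<Otimes>\<^sub>M borel)"
  shows "h \<in> borel_measurable (half_line \<Otimes>\<^sub>M half_line)"
proof -
  have [measurable]: "(\<lambda>x. x) \<in> half_line \<rightarrow>\<^sub>M (borel :: real measure)"
    by (rule measurable_half_line) simp
  have [measurable]: "fst \<in> half_line \<Otimes>\<^sub>M half_line \<rightarrow>\<^sub>M (borel :: real measure)"
    "snd \<in> half_line \<Otimes>\<^sub>M half_line \<rightarrow>\<^sub>M (borel :: real measure)"
    by (rule measurable_compose[OF measurable_fst], simp) (rule measurable_compose[OF measurable_snd], simp)
  have "(\<lambda>z. h (fst z, snd z)) \<in> borel_measurable (half_line \<Otimes>\<^sub>M half_line)"
    by measurable
  then show ?thesis by simp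
qed

lemma weighted_norm_cong:
  assumes "AE x in half_line. f x = f0 x"
  shows "weighted_norm w r f = weighted_norm w r f0"
  unfolding weighted_norm_def nn_integral_lebesgue_on_half_line
  using assms by (intro arg_cong2[where f=ennpow] nn_integral_cong_AE refl) auto

lemma bilinear_form_cong:
  assumes "AE x in half_line. f x = f0 x" "AE x in half_line. g x = g0 x"
  shows "bilinear_form k f g = bilinear_form k f0 g0"
proof -
  have "(\<integral>\<^sup>+ x. ennreal (k x y * f x * g y) \<partial>half_line) = (\<integral>\<^sup>+ x. ennreal (k x y * f0 x * g y) \<partial>half_line)" for y
    using assms(1) by (intro nn_integral_cong_AE) auto
  then show ?thesis
    unfolding bilinear_form_def nn_integral_lebesgue_on_half_line
    using assms(2) by (auto intro!: nn_integral_cong_AE)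
qed

lemma transform_norm_cong:
  assumes "AE x in half_line. f x = f0 x"
  shows "transform_norm k w r f = transform_norm k w r f0"
proof -
  have "(\<integral>\<^sup>+ x. ennreal (k x y * f x) \<partial>half_line) = (\<integral>\<^sup>+ x. ennreal (k x y * f0 x) \<partial>half_line)" for y
    using assms(1) by (intro nn_integral_cong_AE) auto
  then show ?thesis
    unfolding transform_norm_def nn_integral_lebesgue_on_half_line by simp
qed

lemma weighted_norm_eq_0_iff:
  assumes f: "nonneg_measurable f"
  shows "weighted_norm w r f = 0 \<longleftrightarrow> (AE x in half_line. f x = 0)"
proof -
  obtain f0 where f0 [measurable]: "f0 \<in> borel_measurable borel" "\<And>x. 0 \<le> f0 x" "AE x in half_line. f x = f0 x"
    using nonneg_measurable_borel_representative[OF f] by blast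
  have "weighted_norm w r f = 0 \<longleftrightarrow> (\<integral>\<^sup>+ x. ennreal (x powr w * f0 x powr r) \<partial>half_line) = 0"
    unfolding weighted_norm_cong[OF f0(3)] unfolding weighted_norm_def nn_integral_lebesgue_on_half_line by simp
  also have "\<dots> \<longleftrightarrow> (AE x in half_line. ennreal (x powr w * f0 x powr r) = 0)"
    by (rule nn_integral_0_iff_AE, rule measurable_half_line) measurable
  also have "\<dots> \<longleftrightarrow> (AE x in half_line. f x = 0)"
  proof (rule eventually_subst)
    show "AE x in half_line. (ennreal (x powr w * f0 x powr r) = 0) = (f x = 0)"
      using f0(3) AE_space
    proof eventually_elim
      case (elim x)
      then have "0 < x powr w" by (simp add: space_restrict_space)
      then show ?case using elim f0(2)[of x] by (cases "f0 x = 0") (auto simp: ennreal_eq_0_iff mult_le_0_iff not_le)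
    qed
  qed
  finally show ?thesis .
qed

section \<open>Inequality (I) and its equality case\<close>

context hilbert_setting begin

text \<open>Nonzero functions with finite norms have masses m and n that are positive reals, so the
  Hoelder inequality applies with its equality case. Strictness here settles the bound and the case
  of equality in (I) together.\<close>

lemma bilinear_form_less:
  assumes [measurable]: "f \<in> borel_measurable borel" "g \<in> borel_measurable borel"
    and nn: "\<And>x. 0 \<le> f x" "\<And>y. 0 \<le> g y"
    and nz: "\<not> (AE x in half_line. f x = 0)" "\<not> (AE y in half_line. g y = 0)"
    and fin: "weighted_norm wF p f < \<infinity>" "weighted_norm wG q g < \<infinity>"
  shows "bilinear_form k f g < ennreal C * weighted_norm wF p f * weighted_norm wG q g"
proof -
  interpret sigma_finite_measure half_line by (rule sigma_finite_half_line)
  interpret pair_sigma_finite half_line half_line ..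
  have [measurable]: "W f \<in> borel_measurable borel" "V g \<in> borel_measurable borel"
    unfolding W_def[abs_def] V_def[abs_def] by measurable
  have WV: "W f \<in> borel_measurable half_line" "V g \<in> borel_measurable half_line"
    by (auto intro: measurable_half_line)
  note ab = measurable_a[THEN measurable_half_line_pair] measurable_b[THEN measurable_half_line_pair]
  have W_nn: "0 \<le> W f x" "0 \<le> V g y" for x y by (auto simp: W_def V_def nn)
  have Wz: "x > 0 \<Longrightarrow> W f x = 0 \<longleftrightarrow> f x = 0" "x > 0 \<Longrightarrow> V g x = 0 \<longleftrightarrow> g x = 0" for x
    by (auto simp: W_def V_def)
  have norms: "weighted_norm wF p f = ennpow (\<integral>\<^sup>+ x. ennreal (W f x) \<partial>half_line) (1 / p)"
    "weighted_norm wG q g = ennpow (\<integral>\<^sup>+ y. ennreal (V g y) \<partial>half_line) (1 / q)"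
    unfolding weighted_norm_def nn_integral_lebesgue_on_half_line W_def V_def by simp_all
  have nz': "\<not> (AE x in half_line. W f x = 0)" "\<not> (AE y in half_line. V g y = 0)"
    using nz Wz by (auto simp: AE_half_line)
  have "(\<integral>\<^sup>+ x. ennreal (W f x) \<partial>half_line) \<noteq> 0" "(\<integral>\<^sup>+ y. ennreal (V g y) \<partial>half_line) \<noteq> 0"
    using nz' W_nn WV by (auto simp: nn_integral_0_iff_AE order_antisym_conv)
  moreover have "(\<integral>\<^sup>+ x. ennreal (W f x) \<partial>half_line) \<noteq> top" "(\<integral>\<^sup>+ y. ennreal (V g y) \<partial>half_line) \<noteq> top"
    using fin norms by auto
  ultimately obtain m n where m: "(\<integral>\<^sup>+ x. ennreal (W f x) \<partial>half_line) = ennreal m" "0 < m"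
    and n: "(\<integral>\<^sup>+ y. ennreal (V g y) \<partial>half_line) = ennreal n" "0 < n"
    by (metis ennreal_cases ennreal_eq_0_iff linorder_not_le)
  define I where "I = (\<integral>\<^sup>+ y. (\<integral>\<^sup>+ x. ennreal ((a x y * W f x) powr (1 / q') * (b x y * V g y) powr (1 / p')
                  * (W f x * V g y) powr (1 - l)) \<partial>half_line) \<partial>half_line)"
  have exps: "0 < 1 / q'" "0 < 1 / p'" "0 \<le> 1 - l" "1 / q' + 1 / p' + (1 - l) = 1"
    using p'_gt_1 q'_gt_1 l_bounds l by auto
  have exps': "1 / q' + (1 - l) = 1 / p" "1 / p' + (1 - l) = 1 / q"
    using l p' q' by linarith+
  have sp: "x \<in> space half_line \<longleftrightarrow> 0 < x" for x by (simp add: space_restrict_space)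
  note hoelder = markov_hoelder[OF ab WV _ _ _ _ _ _ m(1) n(1) m(2) n(2) exps, folded I_def, unfolded exps']
  have le: "I \<le> ennreal (m powr (1 / p) * n powr (1 / q))"
    by (rule hoelder(1)) (auto simp: sp nn_integral_a nn_integral_b W_nn intro: less_imp_le a_pos b_pos)
  have ne: "I \<noteq> ennreal (m powr (1 / p) * n powr (1 / q))"
  proof
    assume "I = ennreal (m powr (1 / p) * n powr (1 / q))"
    then have "AE x in half_line. AE y in half_line. a x y * (W f x / m) = b x y * (V g y / n)"
      by (rule hoelder(2)[rotated -1]) (auto simp: sp nn_integral_a nn_integral_b W_nn intro: less_imp_le a_pos b_pos)
    then have "(AE x in half_line. W f x / m = 0) \<or> (AE y in half_line. V g y / n = 0)"
    proof (rule homogeneous_kernels_proportional[rotated -2])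
      have "(\<integral>\<^sup>+ y. ennreal (V g y / n) \<partial>half_line) = 1"
        using n W_nn WV by (simp add: divide_ennreal[symmetric] nn_integral_divide ennreal_divide_self cong: nn_integral_cong)
      then show "(\<integral>\<^sup>+ y. ennreal (V g y / n) \<partial>half_line) < \<infinity>" by simp
    qed (use W_nn m n in \<open>auto simp: a_homogeneous b_homogeneous intro: a_pos b_pos\<close>)
    then show False using m n nz' by auto
  qed
  have "bilinear_form k f g = (\<integral>\<^sup>+ y. (\<integral>\<^sup>+ x. ennreal C * ennreal ((a x y * W f x) powr (1 / q') * (b x y * V g y) powr (1 / p')
                  * (W f x * V g y) powr (1 - l)) \<partial>half_line) \<partial>half_line)"
    unfolding bilinear_form_def nn_integral_lebesgue_on_half_line
  proof (intro nn_integral_cong)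
    fix x y assume "x \<in> space half_line" "y \<in> space half_line"
    then show "ennreal (k x y * f x * g y) = ennreal C * ennreal ((a x y * W f x) powr (1 / q') * (b x y * V g y) powr (1 / p')
                  * (W f x * V g y) powr (1 - l))"
      using C_pos nn by (simp add: sp kernel_factorization ennreal_mult)
  qed
  also have "\<dots> = ennreal C * I"
  proof -
    note [measurable] = ab WV
    have [measurable]: "(\<lambda>(x, y). ennreal ((a x y * W f x) powr (1 / q') * (b x y * V g y) powr (1 / p')
                  * (W f x * V g y) powr (1 - l))) \<in> borel_measurable (half_line \<Otimes>\<^sub>M half_line)"
      by measurable
    show ?thesis
      unfolding I_def
      by (subst nn_integral_cmult[symmetric], measurable) (intro nn_integral_cong nn_integral_cmult, measurable)
  qed
  also have "\<dots> < ennreal C * ennreal (m powr (1 / p) * n powr (1 / q))"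
    using le ne C_pos by (intro ennreal_mult_strict_left_mono) (auto simp: order_less_le)
  also have "\<dots> = ennreal C * weighted_norm wF p f * weighted_norm wG q g"
    using m n by (simp add: norms ennpow_ennreal ennreal_mult mult.assoc)
  finally show ?thesis .
qed

lemma bilinear_form_eq_0:
  assumes "(AE x in half_line. f x = 0) \<or> (AE y in half_line. g y = 0)"
  shows "bilinear_form k f g = 0"
proof -
  have "bilinear_form k f g = bilinear_form k f (\<lambda>_. 0)" if "AE y in half_line. g y = 0"
    using that by (intro bilinear_form_cong) auto
  moreover have "bilinear_form k f g = bilinear_form k (\<lambda>_. 0) g" if "AE x in half_line. f x = 0"
    using that by (intro bilinear_form_cong) auto
  ultimately show ?thesis using assms by (auto simp: bilinear_form_def)
qed

text \<open>With 0 * \<infinity> = 0 the right-hand side vanishes as soon as one function does,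
  whatever the other norm is. If neither vanishes, an infinite norm makes the right-hand side
  infinite, since \<open>C\<close> and the other norm are nonzero. In the remaining case the
  inequality is strict.\<close>

lemma
  assumes f: "nonneg_measurable f" and g: "nonneg_measurable g"
  shows bilinear_form_le: "bilinear_form k f g \<le> ennreal C * weighted_norm wF p f * weighted_norm wG q g"
    and bilinear_form_eq_iff: "ennreal C * weighted_norm wF p f * weighted_norm wG q g < \<infinity> \<Longrightarrow>
      bilinear_form k f g = ennreal C * weighted_norm wF p f * weighted_norm wG q g \<longleftrightarrow>
      (AE x in half_line. f x = 0) \<or> (AE y in half_line. g y = 0)"
proof -
  let ?R = "ennreal C * weighted_norm wF p f * weighted_norm wG q g"
  have C0: "ennreal C \<noteq> 0" using C_pos by simp
  have nonzero: "bilinear_form k f g < ?R \<or> ?R = \<infinity>"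
    if nz: "\<not> (AE x in half_line. f x = 0)" "\<not> (AE y in half_line. g y = 0)"
  proof (cases "weighted_norm wF p f < \<infinity> \<and> weighted_norm wG q g < \<infinity>")
    case False
    moreover have "weighted_norm wF p f \<noteq> 0" "weighted_norm wG q g \<noteq> 0"
      using nz f g by (simp_all add: weighted_norm_eq_0_iff)
    moreover from False have "weighted_norm wF p f = top \<or> weighted_norm wG q g = top"
      by (simp add: less_top[symmetric])
    ultimately have "?R = \<infinity>"
      using C0 by (auto simp: ennreal_mult_eq_top_iff)
    then show ?thesis ..
  next
    case True
    obtain f0 where f0: "f0 \<in> borel_measurable borel" "\<And>x. 0 \<le> f0 x" "AE x in half_line. f x = f0 x"
      using nonneg_measurable_borel_representative[OF f] by blast
    obtain g0 where g0: "g0 \<in> borel_measurable borel" "\<And>x. 0 \<le> g0 x" "AE x in half_line. g x = g0 x"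
      using nonneg_measurable_borel_representative[OF g] by blast
    have "(AE x in half_line. f0 x = 0) = (AE x in half_line. f x = 0)"
      "(AE y in half_line. g0 y = 0) = (AE y in half_line. g y = 0)"
      by (rule eventually_subst, use f0(3) in eventually_elim, simp)
         (rule eventually_subst, use g0(3) in eventually_elim, simp)
    with nz have "\<not> (AE x in half_line. f0 x = 0)" "\<not> (AE y in half_line. g0 y = 0)"
      by simp_all
    then show ?thesis
      using True bilinear_form_less[OF f0(1) g0(1) f0(2) g0(2)]
      unfolding bilinear_form_cong[OF f0(3) g0(3)] weighted_norm_cong[OF f0(3)] weighted_norm_cong[OF g0(3)]
      by blast
  qed
  have zero: "bilinear_form k f g = 0" "?R = 0"
    if "(AE x in half_line. f x = 0) \<or> (AE y in half_line. g y = 0)"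
  proof -
    show "bilinear_form k f g = 0" by (rule bilinear_form_eq_0[OF that])
    have "weighted_norm wF p f = 0 \<or> weighted_norm wG q g = 0"
      using that f g by (simp add: weighted_norm_eq_0_iff)
    then show "?R = 0" by auto
  qed
  show "bilinear_form k f g \<le> ?R"
    using nonzero zero by (cases "(AE x in half_line. f x = 0) \<or> (AE y in half_line. g y = 0)") auto
  show "bilinear_form k f g = ?R \<longleftrightarrow> (AE x in half_line. f x = 0) \<or> (AE y in half_line. g y = 0)" if "?R < \<infinity>"
  proof (cases "(AE x in half_line. f x = 0) \<or> (AE y in half_line. g y = 0)")
    case True
    then show ?thesis by (simp add: zero)
  next
    case False
    then have "bilinear_form k f g < ?R" using nonzero that by auto
    then show ?thesis using False by auto
  qed
qed

section \<open>Duality and inequality (II)\<close>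

definition "w = q' / p' * (s1 + s2 - 1) + q' * (A1 - A2)"
definition "T f y = (\<integral>\<^sup>+ x. ennreal (k x y * f x) \<partial>half_line)" for f :: "real \<Rightarrow> real"

text \<open>The weight in (II) is the one dual to the weight of g in (I) under the pairing of T f
  with g.\<close>

lemma dual_weight: "- (q / q') * w = wG"
proof -
  have "wG = q * ((1 - s1 - s2) / p' + A2 - A1)" "w = - q' * ((1 - s1 - s2) / p' + A2 - A1)"
    by (simp_all add: w_def wG_def algebra_simps diff_divide_distrib add_divide_distrib)
  then show ?thesis using q'_gt_1 by simp
qed

lemma conjugate: "1 / q' + 1 / q = 1"
  using q' by simp

lemma transform_norm_eq:
  "transform_norm k w q' f = ennpow (\<integral>\<^sup>+ y. ennreal (y powr w) * ennpow (T f y) q' \<partial>half_line) (1 / q')"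
  by (simp add: transform_norm_def nn_integral_lebesgue_on_half_line T_def)

lemma weighted_norm_dual:
  "ennpow (\<integral>\<^sup>+ y. ennreal (y powr (- (q / q') * w) * h y powr q) \<partial>half_line) (1 / q) = weighted_norm wG q h"
  by (simp only: weighted_norm_def nn_integral_lebesgue_on_half_line dual_weight)

lemma k_nonneg: "0 \<le> k x y"
  by (simp add: k_def exp_kernel_def)

lemma measurable_T [measurable]:
  assumes [measurable]: "f \<in> borel_measurable borel"
  shows "T f \<in> borel_measurable half_line"
proof -
  interpret sigma_finite_measure half_line by (rule sigma_finite_half_line)
  have "(\<lambda>(y, x). ennreal (k x y * f x)) \<in> borel_measurable (borel \<Otimes>\<^sub>M borel)"
    by measurable
  from measurable_half_line_pair[OF this] show ?thesis
    unfolding T_def[abs_def] by (rule borel_measurable_nn_integral)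
qed

lemma bilinear_form_eq_T:
  assumes [measurable]: "f \<in> borel_measurable borel" and nn: "\<And>x. 0 \<le> f x" "\<And>y. 0 < y \<Longrightarrow> 0 \<le> h y"
  shows "bilinear_form k f h = (\<integral>\<^sup>+ y. T f y * ennreal (h y) \<partial>half_line)"
  unfolding bilinear_form_def nn_integral_lebesgue_on_half_line
proof (intro nn_integral_cong)
  fix y assume "y \<in> space half_line"
  then have y: "0 < y" by (simp add: space_restrict_space)
  have "(\<integral>\<^sup>+ x. ennreal (k x y * f x * h y) \<partial>half_line) = (\<integral>\<^sup>+ x. ennreal (k x y * f x) * ennreal (h y) \<partial>half_line)"
    using nn y k_nonneg by (intro nn_integral_cong ennreal_mult) auto
  also have "\<dots> = T f y * ennreal (h y)"
    unfolding T_def by (rule nn_integral_multc, rule measurable_half_line) measurable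
  finally show "(\<integral>\<^sup>+ x. ennreal (k x y * f x * h y) \<partial>half_line) = T f y * ennreal (h y)" .
qed

text \<open>(I) for all h bounds the pairing of T f with h, so the dual description of the norm
  gives (II); conversely Hoelder's inequality gives (I). The bound B is arbitrary, which makes the
  two inequalities equivalent for every constant.\<close>

lemma bilinear_iff_transform:
  assumes f: "nonneg_measurable f"
  shows "(\<forall>h. nonneg_measurable h \<longrightarrow> bilinear_form k f h \<le> B * weighted_norm wG q h)
    \<longleftrightarrow> transform_norm k w q' f \<le> B"
proof -
  obtain f0 where f0 [measurable]: "f0 \<in> borel_measurable borel" and f0_nn: "\<And>x. 0 \<le> f0 x"
    and ff0: "AE x in half_line. f x = f0 x"
    using nonneg_measurable_borel_representative[OF f] by blast
  show ?thesis
  proof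
    assume *: "\<forall>h. nonneg_measurable h \<longrightarrow> bilinear_form k f h \<le> B * weighted_norm wG q h"
    show "transform_norm k w q' f \<le> B"
      unfolding transform_norm_cong[OF ff0] transform_norm_eq
    proof (rule norm_le_of_dual_le[OF q'_gt_1 conjugate])
      fix h :: "real \<Rightarrow> real" assume h: "h \<in> borel_measurable half_line" "\<And>y. 0 \<le> h y"
      have "bilinear_form k f0 h \<le> B * weighted_norm wG q h"
        using *[rule_format, OF nonneg_measurable_of_half_line[OF h]] bilinear_form_cong[OF ff0, of h h k] by simp
      then show "(\<integral>\<^sup>+ y. T f0 y * ennreal (h y) \<partial>half_line)
        \<le> B * ennpow (\<integral>\<^sup>+ y. ennreal (y powr (- (q / q') * w) * h y powr q) \<partial>half_line) (1 / q)"
        unfolding weighted_norm_dual using h by (subst (asm) bilinear_form_eq_T) (auto simp: f0_nn)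
    qed measurable
  next
    assume *: "transform_norm k w q' f \<le> B"
    show "\<forall>h. nonneg_measurable h \<longrightarrow> bilinear_form k f h \<le> B * weighted_norm wG q h"
    proof (intro allI impI)
      fix h assume "nonneg_measurable h"
      then obtain h0 where h0 [measurable]: "h0 \<in> borel_measurable borel" and h0_nn: "\<And>x. 0 \<le> h0 x"
        and hh0: "AE x in half_line. h x = h0 x"
        using nonneg_measurable_borel_representative by blast
      have "bilinear_form k f h = (\<integral>\<^sup>+ y. T f0 y * ennreal (h0 y) \<partial>half_line)"
        unfolding bilinear_form_cong[OF ff0 hh0] by (rule bilinear_form_eq_T) (auto simp: f0_nn h0_nn)
      also have "\<dots> \<le> transform_norm k w q' f * weighted_norm wG q h"
        unfolding transform_norm_cong[OF ff0] weighted_norm_cong[OF hh0] transform_norm_eq weighted_norm_dual[symmetric]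
        by (rule nn_integral_hoelder_weighted[OF q'_gt_1 conjugate]) (auto intro: measurable_half_line simp: h0_nn)
      also have "\<dots> \<le> B * weighted_norm wG q h"
        by (intro mult_right_mono *) simp
      finally show "bilinear_form k f h \<le> B * weighted_norm wG q h" .
    qed
  qed
qed

lemma transform_norm_le:
  assumes f: "nonneg_measurable f"
  shows "transform_norm k w q' f \<le> ennreal C * weighted_norm wF p f"
  using bilinear_iff_transform[OF f] bilinear_form_le[OF f] by blast

text \<open>When the norm of T f is finite, h = y^w (T f)^(q' - 1) attains equality in Hoelder's
  inequality without truncation. It serves to carry an equality in (II) over to an equality in
  (I).\<close>

lemma dual_extremizer:
  assumes f: "nonneg_measurable f" and fin: "transform_norm k w q' f < \<infinity>"
  obtains h where "nonneg_measurable h"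
    "bilinear_form k f h = transform_norm k w q' f * weighted_norm wG q h"
    "weighted_norm wG q h = ennpow (\<integral>\<^sup>+ y. ennreal (y powr w) * ennpow (T f y) q' \<partial>half_line) (1 / q)"
    "bilinear_form k f h < \<infinity>"
proof -
  obtain f0 where f0 [measurable]: "f0 \<in> borel_measurable borel" and f0_nn: "\<And>x. 0 \<le> f0 x"
    and ff0: "AE x in half_line. f x = f0 x"
    using nonneg_measurable_borel_representative[OF f] by blast
  have [measurable]: "(\<lambda>x. x) \<in> borel_measurable half_line"
    by (auto intro: measurable_half_line)
  have TT: "T f = T f0"
    unfolding T_def using ff0 by (intro ext nn_integral_cong_AE) auto
  define D where "D = (\<integral>\<^sup>+ y. ennreal (y powr w) * ennpow (T f y) q' \<partial>half_line)"
  have norm: "transform_norm k w q' f = ennpow D (1 / q')"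
    by (simp add: transform_norm_eq D_def)
  then obtain d where d: "D = ennreal d" "0 \<le> d"
    using fin by (cases D) auto
  have qq: "q * (q' - 1) = q'" using q'_gt_1 q q' by (simp add: field_simps)
  have wq: "wG + w * q = w"
    unfolding dual_weight[symmetric] using q'_gt_1 q q' by (simp add: field_simps) algebra
  \<comment> \<open>\<open>enn2real\<close> sends \<infinity> to 0, which is harmless because T f is
    finite almost everywhere.\<close>
  define h where "h y = y powr w * enn2real (T f y) powr (q' - 1)" for y
  have [measurable]: "h \<in> borel_measurable half_line"
    unfolding h_def[abs_def] TT by measurable
  have hn: "0 \<le> h y" for y by (simp add: h_def)
  have "AE y in half_line. ennreal (y powr w) * ennpow (T f y) q' \<noteq> \<infinity>"
    using d unfolding D_def TT by (intro nn_integral_PInf_AE) auto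
  then have Tfin: "AE y in half_line. 0 < y \<and> T f y \<noteq> \<infinity>"
    using AE_space by eventually_elim (auto simp: space_restrict_space ennreal_mult_top)
  have bil: "bilinear_form k f h = D"
  proof -
    have "bilinear_form k f h = (\<integral>\<^sup>+ y. T f y * ennreal (h y) \<partial>half_line)"
      unfolding bilinear_form_cong[OF ff0 AE_I2, OF refl] TT
      by (rule bilinear_form_eq_T) (auto simp: f0_nn hn)
    also have "\<dots> = D"
      unfolding D_def
    proof (rule nn_integral_cong_AE)
      show "AE y in half_line. T f y * ennreal (h y) = ennreal (y powr w) * ennpow (T f y) q'"
        using Tfin
      proof eventually_elim
        case (elim y)
        then obtain t where t: "T f y = ennreal t" "0 \<le> t" by (cases "T f y") auto
        have "t powr q' = t * t powr (q' - 1)"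
          using t by (cases "t = 0") (auto simp: powr_diff)
        then show ?case
          using t by (simp add: h_def ennpow_ennreal mult_ac flip: ennreal_mult)
      qed
    qed
    finally show ?thesis .
  qed
  have nG: "weighted_norm wG q h = ennpow D (1 / q)"
    unfolding weighted_norm_def nn_integral_lebesgue_on_half_line D_def
  proof (intro arg_cong2[where f=ennpow] refl nn_integral_cong_AE)
    show "AE y in half_line. ennreal (y powr wG * h y powr q) = ennreal (y powr w) * ennpow (T f y) q'"
      using Tfin
    proof eventually_elim
      case (elim y)
      then obtain t where t: "T f y = ennreal t" "0 \<le> t" by (cases "T f y") auto
      have "y powr wG * (y powr w * t powr (q' - 1)) powr q = y powr (wG + w * q) * t powr (q * (q' - 1))"
        by (simp only: powr_mult powr_powr powr_add mult_ac)
      then show ?case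
        unfolding qq wq using t by (simp add: h_def ennpow_ennreal flip: ennreal_mult)
    qed
  qed
  have "D = ennpow D (1 / q') * ennpow D (1 / q)"
    using d conjugate by (simp add: ennpow_ennreal flip: ennreal_mult powr_add)
  then show ?thesis
    using that[of h] nonneg_measurable_of_half_line[of h] hn bil nG norm d by (simp add: D_def)
qed

text \<open>Tested on the extremal h, equality in (II) becomes equality in (I) with a finite
  right-hand side, so f or h vanishes. If h vanishes, so does its norm, hence the norm of T f, and
  then the assumed equality with \<open>C\<close> > 0 makes the norm of f zero.\<close>

lemma transform_norm_eq_iff:
  assumes f: "nonneg_measurable f" and fin: "ennreal C * weighted_norm wF p f < \<infinity>"
  shows "transform_norm k w q' f = ennreal C * weighted_norm wF p f \<longleftrightarrow> (AE x in half_line. f x = 0)"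
proof
  assume "AE x in half_line. f x = 0"
  then show "transform_norm k w q' f = ennreal C * weighted_norm wF p f"
    using transform_norm_le[OF f] weighted_norm_eq_0_iff[OF f, of wF p] by simp
next
  assume eq: "transform_norm k w q' f = ennreal C * weighted_norm wF p f"
  obtain h where h: "nonneg_measurable h"
    "bilinear_form k f h = transform_norm k w q' f * weighted_norm wG q h"
    "weighted_norm wG q h = ennpow (\<integral>\<^sup>+ y. ennreal (y powr w) * ennpow (T f y) q' \<partial>half_line) (1 / q)"
    "bilinear_form k f h < \<infinity>"
    by (rule dual_extremizer[OF f]) (use eq fin in auto)
  consider "AE x in half_line. f x = 0" | "AE x in half_line. h x = 0"
    using bilinear_form_eq_iff[OF f h(1)] h(2,4) eq by auto
  then show "AE x in half_line. f x = 0"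
  proof cases
    case 2
    then have "transform_norm k w q' f = 0"
      using h(3) weighted_norm_eq_0_iff[OF h(1), of wG q] by (simp add: transform_norm_eq)
    then have "weighted_norm wF p f = 0" using eq C_pos by simp
    then show ?thesis using weighted_norm_eq_0_iff[OF f] by simp
  qed
qed

end

theorem theorem4p1:
  fixes p q p' q' l pt qt \<alpha>1 \<alpha>2 s1 s2 A1 A2 K :: real
    and k :: "real \<Rightarrow> real \<Rightarrow> real"
    and normF normG :: "(real \<Rightarrow> real) \<Rightarrow> ennreal"
    and dualF :: "(real \<Rightarrow> real) \<Rightarrow> ennreal"
    and f g :: "real \<Rightarrow> real"
  assumes "p > 1" and "q > 1" and "1 / p + 1 / q \<ge> 1"
    and "1 / p + 1 / p' = 1" and "1 / q + 1 / q' = 1"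
    and "pt \<ge> 0" and "qt \<ge> 0"
    and "\<alpha>1 > 0" and "\<alpha>2 > 0" and "1 / 2 < \<alpha>1 / \<alpha>2" and "\<alpha>1 / \<alpha>2 < 2"
    and "s1 + s2 > 0"
    and "A1 \<in> {(1 - s1 - s2) / p' <..< 1 / p'}"
    and "A2 \<in> {(1 - s1 - s2) / q' <..< 1 / q'}"
    and "nonneg_measurable f" and "nonneg_measurable g"
  defines "l \<equiv> 1 / p' + 1 / q'"
    and "k \<equiv> exp_kernel l s1 s2 \<alpha>1 \<alpha>2 pt qt"
    and "K \<equiv> const_F q' s1 s2 \<alpha>1 \<alpha>2 A2 (q' * pt) (q' * qt)
             * const_G p' s1 s2 \<alpha>1 \<alpha>2 A1 (p' * pt) (p' * qt)"
    and "normF \<equiv> weighted_norm (p / q' * (1 - s1 - s2) + p * (A1 - A2)) p"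
    and "normG \<equiv> weighted_norm (q / p' * (1 - s1 - s2) + q * (A2 - A1)) q"
    and "dualF \<equiv> transform_norm k (q' / p' * (s1 + s2 - 1) + q' * (A1 - A2)) q'"
  shows "(0 < l \<and> l \<le> 1)
    \<comment> \<open>inequality (I)\<close>
    \<and> bilinear_form k f g \<le> ennreal (exp (2 * (pt + qt)) * K) * normF f * normG g
    \<comment> \<open>inequality (II)\<close>
    \<and> dualF f \<le> ennreal (exp (2 * (pt + qt)) * K) * normF f
    \<comment> \<open>equivalence of (I) and (II) for this f; C = exp (2 * (pt + qt)) * K gives the stated constant\<close>
    \<and> (\<forall>C\<ge>0. (\<forall>h. nonneg_measurable h \<longrightarrow>
                  bilinear_form k f h \<le> ennreal C * normF f * normG h)
              \<longleftrightarrow> dualF f \<le> ennreal C * normF f)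
    \<comment> \<open>equality in (I), the right-hand side being finite\<close>
    \<and> (ennreal (exp (2 * (pt + qt)) * K) * normF f * normG g < \<infinity> \<longrightarrow>
         (bilinear_form k f g = ennreal (exp (2 * (pt + qt)) * K) * normF f * normG g
          \<longleftrightarrow> (AE x in lebesgue_on {0<..}. f x = 0) \<or> (AE y in lebesgue_on {0<..}. g y = 0)))
    \<comment> \<open>equality in (II), the right-hand side being finite\<close>
    \<and> (ennreal (exp (2 * (pt + qt)) * K) * normF f < \<infinity> \<longrightarrow>
         (dualF f = ennreal (exp (2 * (pt + qt)) * K) * normF f
          \<longleftrightarrow> (AE x in lebesgue_on {0<..}. f x = 0)))"
proof -
  interpret H: hilbert_setting p q p' q' l pt qt \<alpha>1 \<alpha>2 s1 s2 A1 A2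
    using assms(1-14) by unfold_locales (auto simp: l_def)
  have k: "k = H.k" and K: "exp (2 * (pt + qt)) * K = H.C"
    and normF: "normF = weighted_norm H.wF p" and normG: "normG = weighted_norm H.wG q"
    and dualF: "dualF = transform_norm H.k H.w q'"
    by (simp_all add: k_def H.k_def K_def H.C_def normF_def H.wF_def normG_def H.wG_def dualF_def H.w_def)
  show ?thesis
    unfolding K k normF normG dualF AE_lebesgue_on_half_line
    using H.l_bounds H.bilinear_form_le H.bilinear_form_eq_iff H.transform_norm_le
      H.bilinear_iff_transform H.transform_norm_eq_iff assms(15,16)
    by simp
qed

end
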